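(* Let $\alpha=(\{D_g\}_{g\in G},\{\alpha_g\}_{g\in G})$ be a partial action of a finite groupoid $G$ on a ring $R$ such that each $D_g$ is unital with identity $1_g$ and $R=\bigoplus_{e\in G_0}D_e$. Let $A=R\star_\alpha G$, regard $R$ as an $(A,R^\alpha)$-bimodule and as an $(R^\alpha,A)$-bimodule, and consider the maps $$\tau:R\otimes_A R\to R^\alpha,\quad \tau(x\otimes y)=t_\alpha(xy),\qquad \tau':R\otimes_{R^\alpha}R\to A,\quad \tau'(x\otimes y)=\sum_{g\in G}x\alpha_g(y1_{g^{-1}})\delta_g.$$ Then $R\star_\alpha G$, $R^\alpha$, the two bimodules $R$ and the maps $\tau',\tau$ form a Morita context, namely $(R\star_\alpha G,R^\alpha,R,R,\tau',\tau)$. The map $\tau$ is surjective if and only if there exists $x\in R$ such that $t_\alpha(x)=1_R$.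
   Context: Rings are associative, not necessarily commutative and not necessarily unital; ideals are two-sided; the zero ring counts as unital (with identity $0$). A groupoid is a non-empty set $G$ with a partially defined associative multiplication and inverses (a small category in which every morphism is invertible). For $g\in G$ put $d(g)=g^{-1}g$ and $r(g)=gg^{-1}$; the product $gh$ exists iff $d(g)=r(h)$, and $G^2=\{(g,h): d(g)=r(h)\}$. $G_0$ is the set of identities $\{d(g):g\in G\}$. A partial action of $G$ on a ring $R$ is a pair $\alpha=(\{D_g\}_{g\in G},\{\alpha_g\}_{g\in G})$ where, for each $g\in G$, $D_{r(g)}$ is an ideal of $R$, $D_g$ is an ideal of $D_{r(g)}$, and $\alpha_g:D_{g^{-1}}\to D_g$ is a ring isomorphism, such that: (i) $\alpha_e=\mathrm{id}_{D_e}$ for all $e\in G_0$; (ii) $\alpha_h^{-1}(D_{g^{-1}}\cap D_h)\subseteq D_{(gh)^{-1}}$ for all $(g,h)\in G^2$; (iii) $\alpha_g(\alpha_h(x))=\alpha_{gh}(x)$ for all $(g,h)\in G^2$ and $x\in\alpha_h^{-1}(D_{g^{-1}}\cap D_h)$. Here $R=\bigoplus_{e\in G_0}D_e$ is the internal direct sum of the ideals $D_e$, so $R$ is unital with $1_R=\sum_{e\in G_0}1_e$; each $1_g$ is a central idempotent of $R$ and $D_g=R1_g$. Subring of invariants: $R^\alpha=\{x\in R:\alpha_g(x1_{g^{-1}})=x1_g\text{ for all }g\in G\}$. Trace map: $t_\alpha:R\to R$, $t_\alpha(x)=\sum_{g\in G}\alpha_g(x1_{g^{-1}})$; its image lies in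 $R^\alpha$. Partial skew groupoid ring: $R\star_\alpha G=\bigoplus_{g\in G}D_g\delta_g$, with $\delta_g$ symbols, usual addition, and $(x\delta_g)(y\delta_h)=\alpha_g(\alpha_{g^{-1}}(x)y)\delta_{gh}$ if $(g,h)\in G^2$ and $0$ otherwise ($x\in D_g$, $y\in D_h$); its identity is $\sum_{e\in G_0}1_e\delta_e$. Module structures on $R$: $R^\alpha$ acts by multiplication on either side; $R\star_\alpha G$ acts on the left by $a\delta_g\cdot x=a\alpha_g(x1_{g^{-1}})$ and on the right by $x\cdot a\delta_g=\alpha_{g^{-1}}(xa)$, for $g\in G$, $a\in D_g$, $x\in R$. A Morita context is a six-tuple $(S,S',M,M',\sigma,\sigma')$ where $S,S'$ are unital rings, $M$ is an $(S,S')$-bimodule, $M'$ is an $(S',S)$-bimodule, and $\sigma:M\otimes_{S'}M'\to S$, $\sigma':M'\otimes_S M\to S'$ are bimodule maps such that $\sigma(x\otimes x')y=x\sigma'(x'\otimes y)$ and $\sigma'(x'\otimes x)y'=x'\sigma(x\otimes y')$ for all $x,y\in M$, $x',y'\in M'$. *)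

theory Defs
  imports "HOL-Algebra.Algebra"
begin

section \<open>Rings without identity\<close>

text \<open>Rings here need not have an identity. They are represented by HOL-Algebra's ring
  records, whose field \<open>one\<close> is left unconstrained (and is never used) for such rings.\<close>

locale nonunital_ring = abelian_group R for R (structure) +
  assumes m_closed: "\<lbrakk>x \<in> carrier R; y \<in> carrier R\<rbrakk> \<Longrightarrow> x \<otimes> y \<in> carrier R"
    and m_assoc: "\<lbrakk>x \<in> carrier R; y \<in> carrier R; z \<in> carrier R\<rbrakk>
      \<Longrightarrow> (x \<otimes> y) \<otimes> z = x \<otimes> (y \<otimes> z)"
    and l_distr: "\<lbrakk>x \<in> carrier R; y \<in> carrier R; z \<in> carrier R\<rbrakk>
      \<Longrightarrow> (x \<oplus> y) \<otimes> z = x \<otimes> z \<oplus> y \<otimes> z"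
    and r_distr: "\<lbrakk>x \<in> carrier R; y \<in> carrier R; z \<in> carrier R\<rbrakk>
      \<Longrightarrow> z \<otimes> (x \<oplus> y) = z \<otimes> x \<oplus> z \<otimes> y"

locale nonunital_ideal = nonunital_ring R + additive_subgroup I R for I and R (structure) +
  assumes I_l_closed: "\<lbrakk>a \<in> I; x \<in> carrier R\<rbrakk> \<Longrightarrow> x \<otimes> a \<in> I"
    and I_r_closed: "\<lbrakk>a \<in> I; x \<in> carrier R\<rbrakk> \<Longrightarrow> a \<otimes> x \<in> I"

definition nonunital_ring_iso ::
  "('a, 'm) ring_scheme \<Rightarrow> ('b, 'n) ring_scheme \<Rightarrow> ('a \<Rightarrow> 'b) set" where
  "nonunital_ring_iso R S =
    {h. bij_betw h (carrier R) (carrier S) \<and>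
        (\<forall>x\<in>carrier R. \<forall>y\<in>carrier R.
          h (x \<oplus>\<^bsub>R\<^esub> y) = h x \<oplus>\<^bsub>S\<^esub> h y \<and> h (x \<otimes>\<^bsub>R\<^esub> y) = h x \<otimes>\<^bsub>S\<^esub> h y)}"

definition is_identity :: "('a, 'm) ring_scheme \<Rightarrow> 'a set \<Rightarrow> 'a \<Rightarrow> bool" where
  "is_identity R I u \<longleftrightarrow> u \<in> I \<and> (\<forall>x\<in>I. u \<otimes>\<^bsub>R\<^esub> x = x \<and> x \<otimes>\<^bsub>R\<^esub> u = x)"

text \<open>\<open>R\<close> is the internal direct sum of the finitely many ideals \<open>D e\<close>, \<open>e \<in> E\<close>.\<close>

definition internal_direct_sum :: "('a, 'm) ring_scheme \<Rightarrow> 'i set \<Rightarrow> ('i \<Rightarrow> 'a set) \<Rightarrow> bool" where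
  "internal_direct_sum R E D \<longleftrightarrow> finite E \<and> (\<forall>e\<in>E. nonunital_ideal (D e) R) \<and>
    (\<forall>x\<in>carrier R. \<exists>!f. f \<in> (\<Pi>\<^sub>E e\<in>E. D e) \<and> x = (\<Oplus>\<^bsub>R\<^esub>e\<in>E. f e))"


section \<open>Groupoids\<close>

text \<open>The product of \<open>g\<close> and \<open>h\<close> is regarded as defined iff \<open>gdom G g = gran G h\<close>;
  the values of \<open>gcomp G\<close> on other pairs are irrelevant.\<close>

record 'g gpd = "'g partial_object" +
  gcomp :: "'g \<Rightarrow> 'g \<Rightarrow> 'g"
  ginv :: "'g \<Rightarrow> 'g"

definition gdom :: "('g, 'm) gpd_scheme \<Rightarrow> 'g \<Rightarrow> 'g" where
  "gdom G g = gcomp G (ginv G g) g"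

definition gran :: "('g, 'm) gpd_scheme \<Rightarrow> 'g \<Rightarrow> 'g" where
  "gran G g = gcomp G g (ginv G g)"

definition composable :: "('g, 'm) gpd_scheme \<Rightarrow> ('g \<times> 'g) set" where
  "composable G = {(g, h). g \<in> carrier G \<and> h \<in> carrier G \<and> gdom G g = gran G h}"

definition identities :: "('g, 'm) gpd_scheme \<Rightarrow> 'g set" where
  "identities G = gdom G ` carrier G"

locale groupoid =
  fixes G :: "('g, 'm) gpd_scheme"
  assumes nonempty: "carrier G \<noteq> {}"
    and ginv_closed: "g \<in> carrier G \<Longrightarrow> ginv G g \<in> carrier G"
    and gcomp_closed: "(g, h) \<in> composable G \<Longrightarrow> gcomp G g h \<in> carrier G"
    and gdom_gcomp: "(g, h) \<in> composable G \<Longrightarrow> gdom G (gcomp G g h) = gdom G h"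
    and gran_gcomp: "(g, h) \<in> composable G \<Longrightarrow> gran G (gcomp G g h) = gran G g"
    and gcomp_assoc: "\<lbrakk>(g, h) \<in> composable G; (h, k) \<in> composable G\<rbrakk>
      \<Longrightarrow> gcomp G (gcomp G g h) k = gcomp G g (gcomp G h k)"
    and gdom_ginv: "g \<in> carrier G \<Longrightarrow> gdom G (ginv G g) = gran G g"
    and gran_ginv: "g \<in> carrier G \<Longrightarrow> gran G (ginv G g) = gdom G g"
    and gcomp_gdom: "g \<in> carrier G \<Longrightarrow> gcomp G g (gdom G g) = g"
    and gran_gcomp_self: "g \<in> carrier G \<Longrightarrow> gcomp G (gran G g) g = g"


section \<open>Partial actions\<close>

text \<open>\<open>\<alpha> g\<close> matters only on \<open>D (ginv G g)\<close>. The set \<open>\<alpha>\<^sub>h\<^sup>-\<^sup>1(D\<^bsub>g\<^sup>-\<^sup>1\<^esub> \<inter> D\<^sub>h)\<close> is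
  written out as a preimage.\<close>

locale partial_action = groupoid G + nonunital_ring R
  for G :: "('g, 'k) gpd_scheme" and R :: "('a, 'm) ring_scheme" (structure) +
  fixes D :: "'g \<Rightarrow> 'a set" and \<alpha> :: "'g \<Rightarrow> 'a \<Rightarrow> 'a"
  assumes D_gran_ideal: "g \<in> carrier G \<Longrightarrow> nonunital_ideal (D (gran G g)) R"
    and D_ideal: "g \<in> carrier G \<Longrightarrow> nonunital_ideal (D g) (R\<lparr>carrier := D (gran G g)\<rparr>)"
    and \<alpha>_iso: "g \<in> carrier G \<Longrightarrow>
      \<alpha> g \<in> nonunital_ring_iso (R\<lparr>carrier := D (ginv G g)\<rparr>) (R\<lparr>carrier := D g\<rparr>)"
    and \<alpha>_identity: "\<lbrakk>e \<in> identities G; x \<in> D e\<rbrakk> \<Longrightarrow> \<alpha> e x = x"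
    and \<alpha>_domain: "(g, h) \<in> composable G \<Longrightarrow>
      {x \<in> D (ginv G h). \<alpha> h x \<in> D (ginv G g) \<inter> D h} \<subseteq> D (ginv G (gcomp G g h))"
    and \<alpha>_comp: "\<lbrakk>(g, h) \<in> composable G; x \<in> D (ginv G h); \<alpha> h x \<in> D (ginv G g) \<inter> D h\<rbrakk>
      \<Longrightarrow> \<alpha> g (\<alpha> h x) = \<alpha> (gcomp G g h) x"

text \<open>Below \<open>u g\<close> is the identity \<open>1\<^sub>g\<close> of \<open>D g\<close>, and \<open>G\<close> is finite. When \<open>R\<close> is
  the direct sum of the \<open>D e\<close>, its identity is the sum of the \<open>1\<^sub>e\<close>.\<close>

definition unity :: "('g, 'k) gpd_scheme \<Rightarrow> ('a, 'm) ring_scheme \<Rightarrow> ('g \<Rightarrow> 'a) \<Rightarrow> 'a" where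
  "unity G R u = (\<Oplus>\<^bsub>R\<^esub>e\<in>identities G. u e)"

definition invariant_ring ::
  "('g, 'k) gpd_scheme \<Rightarrow> ('a, 'm) ring_scheme \<Rightarrow> ('g \<Rightarrow> 'a \<Rightarrow> 'a) \<Rightarrow> ('g \<Rightarrow> 'a) \<Rightarrow> 'a ring" where
  "invariant_ring G R \<alpha> u =
    \<lparr>carrier = {x \<in> carrier R. \<forall>g\<in>carrier G. \<alpha> g (x \<otimes>\<^bsub>R\<^esub> u (ginv G g)) = x \<otimes>\<^bsub>R\<^esub> u g},
     monoid.mult = monoid.mult R, one = unity G R u, ring.zero = ring.zero R, add = add R\<rparr>"

definition trace_map ::
  "('g, 'k) gpd_scheme \<Rightarrow> ('a, 'm) ring_scheme \<Rightarrow> ('g \<Rightarrow> 'a \<Rightarrow> 'a) \<Rightarrow> ('g \<Rightarrow> 'a) \<Rightarrow> 'a \<Rightarrow> 'a" where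
  "trace_map G R \<alpha> u x = (\<Oplus>\<^bsub>R\<^esub>g\<in>carrier G. \<alpha> g (x \<otimes>\<^bsub>R\<^esub> u (ginv G g)))"

text \<open>For finite \<open>G\<close>, the element \<open>\<Sum>g. a\<^sub>g \<delta>\<^sub>g\<close> of the partial skew groupoid ring is
  represented by the function \<open>g \<mapsto> a\<^sub>g\<close>. The product is the biadditive extension of
  the rule for \<open>(x \<delta>\<^sub>g)(y \<delta>\<^sub>h)\<close>: its coefficient at \<open>k\<close> collects the pairs with \<open>gh = k\<close>.\<close>

definition skew_ring ::
  "('g, 'k) gpd_scheme \<Rightarrow> ('a, 'm) ring_scheme \<Rightarrow> ('g \<Rightarrow> 'a set) \<Rightarrow> ('g \<Rightarrow> 'a \<Rightarrow> 'a)
    \<Rightarrow> ('g \<Rightarrow> 'a) \<Rightarrow> ('g \<Rightarrow> 'a) ring" where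
  "skew_ring G R D \<alpha> u =
    \<lparr>carrier = (\<Pi>\<^sub>E g\<in>carrier G. D g),
     monoid.mult = (\<lambda>a b. \<lambda>k\<in>carrier G.
       \<Oplus>\<^bsub>R\<^esub>p\<in>{(g, h). (g, h) \<in> composable G \<and> gcomp G g h = k}.
         case p of (g, h) \<Rightarrow> \<alpha> g (\<alpha> (ginv G g) (a g) \<otimes>\<^bsub>R\<^esub> b h)),
     one = (\<lambda>g\<in>carrier G. if g \<in> identities G then u g else \<zero>\<^bsub>R\<^esub>),
     ring.zero = (\<lambda>g\<in>carrier G. \<zero>\<^bsub>R\<^esub>),
     add = (\<lambda>a b. \<lambda>g\<in>carrier G. a g \<oplus>\<^bsub>R\<^esub> b g)\<rparr>"

definition skew_lact ::
  "('g, 'k) gpd_scheme \<Rightarrow> ('a, 'm) ring_scheme \<Rightarrow> ('g \<Rightarrow> 'a \<Rightarrow> 'a) \<Rightarrow> ('g \<Rightarrow> 'a)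
    \<Rightarrow> ('g \<Rightarrow> 'a) \<Rightarrow> 'a \<Rightarrow> 'a" where
  "skew_lact G R \<alpha> u a x = (\<Oplus>\<^bsub>R\<^esub>g\<in>carrier G. a g \<otimes>\<^bsub>R\<^esub> \<alpha> g (x \<otimes>\<^bsub>R\<^esub> u (ginv G g)))"

definition skew_ract ::
  "('g, 'k) gpd_scheme \<Rightarrow> ('a, 'm) ring_scheme \<Rightarrow> ('g \<Rightarrow> 'a \<Rightarrow> 'a) \<Rightarrow> 'a \<Rightarrow> ('g \<Rightarrow> 'a) \<Rightarrow> 'a" where
  "skew_ract G R \<alpha> x a = (\<Oplus>\<^bsub>R\<^esub>g\<in>carrier G. \<alpha> (ginv G g) (x \<otimes>\<^bsub>R\<^esub> a g))"


section \<open>Bimodules over unital rings, tensor products and Morita contexts\<close>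

text \<open>As for HOL-Algebra's record \<open>module\<close>, only the additive part of the inherited ring
  record is meaningful.\<close>

record ('s, 't, 'a) bimod = "'a ring" +
  lact :: "'s \<Rightarrow> 'a \<Rightarrow> 'a"
  ract :: "'a \<Rightarrow> 't \<Rightarrow> 'a"

locale bimodule = S: ring S + T: ring T + M: abelian_group M
  for S :: "('s, 'k) ring_scheme" and T :: "('t, 'l) ring_scheme"
    and M :: "('s, 't, 'a, 'm) bimod_scheme" +
  assumes lact_closed: "\<lbrakk>s \<in> carrier S; x \<in> carrier M\<rbrakk> \<Longrightarrow> lact M s x \<in> carrier M"
    and lact_add: "\<lbrakk>s \<in> carrier S; x \<in> carrier M; y \<in> carrier M\<rbrakk>
      \<Longrightarrow> lact M s (x \<oplus>\<^bsub>M\<^esub> y) = lact M s x \<oplus>\<^bsub>M\<^esub> lact M s y"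
    and add_lact: "\<lbrakk>s \<in> carrier S; s' \<in> carrier S; x \<in> carrier M\<rbrakk>
      \<Longrightarrow> lact M (s \<oplus>\<^bsub>S\<^esub> s') x = lact M s x \<oplus>\<^bsub>M\<^esub> lact M s' x"
    and mult_lact: "\<lbrakk>s \<in> carrier S; s' \<in> carrier S; x \<in> carrier M\<rbrakk>
      \<Longrightarrow> lact M (s \<otimes>\<^bsub>S\<^esub> s') x = lact M s (lact M s' x)"
    and one_lact: "x \<in> carrier M \<Longrightarrow> lact M \<one>\<^bsub>S\<^esub> x = x"
    and ract_closed: "\<lbrakk>t \<in> carrier T; x \<in> carrier M\<rbrakk> \<Longrightarrow> ract M x t \<in> carrier M"
    and ract_add: "\<lbrakk>t \<in> carrier T; x \<in> carrier M; y \<in> carrier M\<rbrakk>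
      \<Longrightarrow> ract M (x \<oplus>\<^bsub>M\<^esub> y) t = ract M x t \<oplus>\<^bsub>M\<^esub> ract M y t"
    and add_ract: "\<lbrakk>t \<in> carrier T; t' \<in> carrier T; x \<in> carrier M\<rbrakk>
      \<Longrightarrow> ract M x (t \<oplus>\<^bsub>T\<^esub> t') = ract M x t \<oplus>\<^bsub>M\<^esub> ract M x t'"
    and mult_ract: "\<lbrakk>t \<in> carrier T; t' \<in> carrier T; x \<in> carrier M\<rbrakk>
      \<Longrightarrow> ract M x (t \<otimes>\<^bsub>T\<^esub> t') = ract M (ract M x t) t'"
    and one_ract: "x \<in> carrier M \<Longrightarrow> ract M x \<one>\<^bsub>T\<^esub> = x"
    and lact_ract: "\<lbrakk>s \<in> carrier S; t \<in> carrier T; x \<in> carrier M\<rbrakk>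
      \<Longrightarrow> ract M (lact M s x) t = lact M s (ract M x t)"

definition as_bimod ::
  "('a, 'm) ring_scheme \<Rightarrow> ('s \<Rightarrow> 'a \<Rightarrow> 'a) \<Rightarrow> ('a \<Rightarrow> 't \<Rightarrow> 'a) \<Rightarrow> ('s, 't, 'a) bimod" where
  "as_bimod R l r = \<lparr>carrier = carrier R, monoid.mult = monoid.mult R, one = one R,
     ring.zero = ring.zero R, add = add R,
     lact = l, ract = r\<rparr>"

definition regular_bimod :: "('s, 'm) ring_scheme \<Rightarrow> ('s, 's, 's) bimod" where
  "regular_bimod S = as_bimod S (monoid.mult S) (monoid.mult S)"

definition bimod_hom ::
  "('s, 'k) ring_scheme \<Rightarrow> ('t, 'l) ring_scheme \<Rightarrow> ('s, 't, 'a, 'm) bimod_scheme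
    \<Rightarrow> ('s, 't, 'b, 'n) bimod_scheme \<Rightarrow> ('a \<Rightarrow> 'b) set" where
  "bimod_hom S T M N = {f \<in> carrier M \<rightarrow> carrier N.
     (\<forall>x\<in>carrier M. \<forall>y\<in>carrier M. f (x \<oplus>\<^bsub>M\<^esub> y) = f x \<oplus>\<^bsub>N\<^esub> f y) \<and>
     (\<forall>s\<in>carrier S. \<forall>x\<in>carrier M. f (lact M s x) = lact N s (f x)) \<and>
     (\<forall>t\<in>carrier T. \<forall>x\<in>carrier M. f (ract M x t) = ract N (f x) t)}"

text \<open>The tensor product of \<open>M\<close> and \<open>N\<close> over \<open>T\<close> is the quotient of the free abelian group
  on pairs by the subgroup generated by the usual relations.\<close>

abbreviation tensor_free ::
  "('s, 't, 'a, 'm) bimod_scheme \<Rightarrow> ('t, 'v, 'b, 'n) bimod_scheme \<Rightarrow> ('a \<times> 'b \<Rightarrow>\<^sub>0 int) monoid" where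
  "tensor_free M N \<equiv> free_Abelian_group (carrier M \<times> carrier N)"

definition tensor_relations ::
  "('t, 'l) ring_scheme \<Rightarrow> ('s, 't, 'a, 'm) bimod_scheme \<Rightarrow> ('t, 'v, 'b, 'n) bimod_scheme
    \<Rightarrow> ('a \<times> 'b \<Rightarrow>\<^sub>0 int) set" where
  "tensor_relations T M N =
     {frag_of (x \<oplus>\<^bsub>M\<^esub> x', y) - frag_of (x, y) - frag_of (x', y) | x x' y.
        x \<in> carrier M \<and> x' \<in> carrier M \<and> y \<in> carrier N} \<union>
     {frag_of (x, y \<oplus>\<^bsub>N\<^esub> y') - frag_of (x, y) - frag_of (x, y') | x y y'.
        x \<in> carrier M \<and> y \<in> carrier N \<and> y' \<in> carrier N} \<union>
     {frag_of (ract M x t, y) - frag_of (x, lact N t y) | x t y.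
        x \<in> carrier M \<and> t \<in> carrier T \<and> y \<in> carrier N}"

definition tensor_kernel ::
  "('t, 'l) ring_scheme \<Rightarrow> ('s, 't, 'a, 'm) bimod_scheme \<Rightarrow> ('t, 'v, 'b, 'n) bimod_scheme
    \<Rightarrow> ('a \<times> 'b \<Rightarrow>\<^sub>0 int) set" where
  "tensor_kernel T M N = generate (tensor_free M N) (tensor_relations T M N)"

definition tensor_class ::
  "('t, 'l) ring_scheme \<Rightarrow> ('s, 't, 'a, 'm) bimod_scheme \<Rightarrow> ('t, 'v, 'b, 'n) bimod_scheme
    \<Rightarrow> ('a \<times> 'b \<Rightarrow>\<^sub>0 int) \<Rightarrow> ('a \<times> 'b \<Rightarrow>\<^sub>0 int) set" where
  "tensor_class T M N c = tensor_kernel T M N #>\<^bsub>tensor_free M N\<^esub> c"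

definition pure_tensor ::
  "('t, 'l) ring_scheme \<Rightarrow> ('s, 't, 'a, 'm) bimod_scheme \<Rightarrow> ('t, 'v, 'b, 'n) bimod_scheme
    \<Rightarrow> 'a \<Rightarrow> 'b \<Rightarrow> ('a \<times> 'b \<Rightarrow>\<^sub>0 int) set" where
  "pure_tensor T M N x y = tensor_class T M N (frag_of (x, y))"

text \<open>The actions are those induced on cosets by \<open>s \<cdot> (x, y) = (s x, y)\<close> and
  \<open>(x, y) \<cdot> v = (x, y v)\<close>; the fields \<open>mult\<close> and \<open>one\<close> are meaningless.\<close>

definition tensor ::
  "('t, 'l) ring_scheme \<Rightarrow> ('s, 't, 'a, 'm) bimod_scheme \<Rightarrow> ('t, 'v, 'b, 'n) bimod_scheme
    \<Rightarrow> ('s, 'v, ('a \<times> 'b \<Rightarrow>\<^sub>0 int) set) bimod" where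
  "tensor T M N =
    \<lparr>carrier = carrier (tensor_free M N Mod tensor_kernel T M N),
     monoid.mult = undefined, one = undefined,
     ring.zero = \<one>\<^bsub>tensor_free M N Mod tensor_kernel T M N\<^esub>,
     add = monoid.mult (tensor_free M N Mod tensor_kernel T M N),
     lact = (\<lambda>s C. the_elem
       ((\<lambda>c. tensor_class T M N (frag_extend (\<lambda>(x, y). frag_of (lact M s x, y)) c)) ` C)),
     ract = (\<lambda>C v. the_elem
       ((\<lambda>c. tensor_class T M N (frag_extend (\<lambda>(x, y). frag_of (x, ract N y v)) c)) ` C))\<rparr>"

text \<open>The map into the additive group of \<open>B\<close> induced on a tensor product by a map \<open>f\<close> of two
  arguments: extend \<open>f\<close> additively to the free abelian group and pass to cosets. It
  is meaningful when \<open>f\<close> is biadditive and balanced.\<close>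

definition tensor_lift ::
  "('c, 'm) ring_scheme \<Rightarrow> ('a \<Rightarrow> 'b \<Rightarrow> 'c) \<Rightarrow> ('a \<times> 'b \<Rightarrow>\<^sub>0 int) set \<Rightarrow> 'c" where
  "tensor_lift B f C = the_elem
     ((\<lambda>c. \<Oplus>\<^bsub>B\<^esub>p\<in>Poly_Mapping.keys c. [Poly_Mapping.lookup c p] \<cdot>\<^bsub>B\<^esub> f (fst p) (snd p)) ` C)"

locale morita_context = M: bimodule S S' M + M': bimodule S' S M'
  for S :: "('s, 'k) ring_scheme" and S' :: "('t, 'l) ring_scheme"
    and M :: "('s, 't, 'a, 'm) bimod_scheme" and M' :: "('t, 's, 'b, 'n) bimod_scheme" +
  fixes \<sigma> :: "('a \<times> 'b \<Rightarrow>\<^sub>0 int) set \<Rightarrow> 's" and \<sigma>' :: "('b \<times> 'a \<Rightarrow>\<^sub>0 int) set \<Rightarrow> 't"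
  assumes \<sigma>_hom: "\<sigma> \<in> bimod_hom S S (tensor S' M M') (regular_bimod S)"
    and \<sigma>'_hom: "\<sigma>' \<in> bimod_hom S' S' (tensor S M' M) (regular_bimod S')"
    and \<sigma>_\<sigma>': "\<lbrakk>x \<in> carrier M; x' \<in> carrier M'; y \<in> carrier M\<rbrakk>
      \<Longrightarrow> lact M (\<sigma> (pure_tensor S' M M' x x')) y = ract M x (\<sigma>' (pure_tensor S M' M x' y))"
    and \<sigma>'_\<sigma>: "\<lbrakk>x' \<in> carrier M'; x \<in> carrier M; y' \<in> carrier M'\<rbrakk>
      \<Longrightarrow> lact M' (\<sigma>' (pure_tensor S M' M x' x)) y' = ract M' x' (\<sigma> (pure_tensor S' M M' x y'))"


section \<open>The bimodules \<open>R\<close> and the maps \<open>\<tau>\<close> and \<open>\<tau>'\<close>\<close>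

definition R_skew_inv ::
  "('g, 'k) gpd_scheme \<Rightarrow> ('a, 'm) ring_scheme \<Rightarrow> ('g \<Rightarrow> 'a \<Rightarrow> 'a) \<Rightarrow> ('g \<Rightarrow> 'a)
    \<Rightarrow> ('g \<Rightarrow> 'a, 'a, 'a) bimod" where
  "R_skew_inv G R \<alpha> u = as_bimod R (skew_lact G R \<alpha> u) (monoid.mult R)"

definition R_inv_skew ::
  "('g, 'k) gpd_scheme \<Rightarrow> ('a, 'm) ring_scheme \<Rightarrow> ('g \<Rightarrow> 'a \<Rightarrow> 'a)
    \<Rightarrow> ('a, 'g \<Rightarrow> 'a, 'a) bimod" where
  "R_inv_skew G R \<alpha> = as_bimod R (monoid.mult R) (skew_ract G R \<alpha>)"

definition tau ::
  "('g, 'k) gpd_scheme \<Rightarrow> ('a, 'm) ring_scheme \<Rightarrow> ('g \<Rightarrow> 'a \<Rightarrow> 'a) \<Rightarrow> ('g \<Rightarrow> 'a)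
    \<Rightarrow> ('a \<times> 'a \<Rightarrow>\<^sub>0 int) set \<Rightarrow> 'a" where
  "tau G R \<alpha> u = tensor_lift (invariant_ring G R \<alpha> u) (\<lambda>x y. trace_map G R \<alpha> u (x \<otimes>\<^bsub>R\<^esub> y))"

definition tau' ::
  "('g, 'k) gpd_scheme \<Rightarrow> ('a, 'm) ring_scheme \<Rightarrow> ('g \<Rightarrow> 'a set) \<Rightarrow> ('g \<Rightarrow> 'a \<Rightarrow> 'a)
    \<Rightarrow> ('g \<Rightarrow> 'a) \<Rightarrow> ('a \<times> 'a \<Rightarrow>\<^sub>0 int) set \<Rightarrow> ('g \<Rightarrow> 'a)" where
  "tau' G R D \<alpha> u = tensor_lift (skew_ring G R D \<alpha> u)
     (\<lambda>x y. \<lambda>g\<in>carrier G. x \<otimes>\<^bsub>R\<^esub> \<alpha> g (y \<otimes>\<^bsub>R\<^esub> u (ginv G g)))"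

end

theory Submission
  imports Defs
begin

text \<open>Each partial isomorphism \<open>\<alpha> g\<close> extends to a map defined on all of \<open>R\<close>, namely
\<open>\<beta> g x = \<alpha> g (x 1\<^bsub>g\<^sup>-\<^sup>1\<^esub>)\<close>: first project onto the ideal where \<open>\<alpha> g\<close> lives, which is possible because
that ideal is generated by a central idempotent of \<open>R\<close>. These maps preserve sums and products,
and the axioms of a partial action condense into one rule without domain conditions:
\<open>\<beta> g (\<beta> h x)\<close> is \<open>\<beta> (gh) x \<cdot> 1\<^sub>g\<close> when \<open>gh\<close> is defined (\<open>\<beta>_composable\<close>) and zero otherwise
(\<open>\<beta>_not_composable\<close>). The factor \<open>1\<^sub>g\<close> reflects that \<open>\<alpha> g\<close> after \<open>\<alpha> h\<close> is only a restriction of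
\<open>\<alpha> (gh)\<close>. It comes from \<open>\<alpha>_u_u\<close>: \<open>\<alpha> g\<close> carries the ideal \<open>D\<^bsub>g\<^sup>-\<^sup>1\<^esub> \<inter> D\<^sub>h\<close> onto \<open>D\<^sub>g \<inter> D\<^bsub>gh\<^esub>\<close>, hence
identity to identity.

Everything else is a computation with this rule. In terms of \<open>\<beta>\<close>, the product of the partial skew
groupoid ring is \<open>(x \<delta>\<^sub>g)(y \<delta>\<^sub>h) = x \<beta> g y \<delta>\<^bsub>gh\<^esub>\<close>, its two actions on \<open>R\<close> are
\<open>x \<delta>\<^sub>g \<cdot> y = x \<beta> g y\<close> and \<open>y \<cdot> x \<delta>\<^sub>g = \<beta> g\<^sup>-\<^sup>1 (y x)\<close>, and an element \<open>b\<close> is invariant iff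
\<open>\<beta> g b = b 1\<^sub>g\<close> for all \<open>g\<close>. All identities involving the skew ring are additive in each of its
elements, so they only have to be checked on the monomials \<open>x \<delta>\<^sub>g\<close> (\<open>skew_induct\<close>); this
gives the ring and the two bimodules.

The trace is \<open>\<Sum>g. \<beta> g x\<close>. It is invariant because left translation by \<open>h\<close> is a bijection
from the elements with range \<open>d(h)\<close> onto those with range \<open>r(h)\<close>, and it is unchanged under
\<open>x \<mapsto> \<beta> h\<^sup>-\<^sup>1 x\<close> for \<open>x \<in> D\<^sub>h\<close> because right translation by \<open>h\<^sup>-\<^sup>1\<close> is a bijection from the elements
with source \<open>d(h)\<close> onto those with source \<open>r(h)\<close>; the latter implies that \<open>(x, y) \<mapsto> tr (x y)\<close> is
balanced over the skew ring. Likewise \<open>(x, y) \<mapsto> \<Sum>g. x \<beta> g y \<delta>\<^sub>g\<close> is balanced over the invariants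
and linear over the skew ring on both sides. Hence both maps descend to the tensor products, and
the two compatibility conditions of a Morita context read
\<open>\<Sum>g. x \<beta> g y \<beta> g z = x tr (y z)\<close> and \<open>\<Sum>g. \<beta> g\<^sup>-\<^sup>1 (x y \<beta> g z) = tr (x y) z\<close>.

Finally, the image of the map induced by \<open>tr (x y)\<close> is generated by traces and hence consists of
traces; so if it contains all invariants, then \<open>1\<close> is a trace. Conversely, if \<open>tr x = 1\<close>, then every
invariant \<open>b\<close> equals \<open>b tr x = tr (b x)\<close>, the image of \<open>b \<otimes> x\<close>.\<close>

section \<open>Additive maps and formal integer combinations\<close>

lemma abelian_group_homI_additive:
  assumes "abelian_group A" "abelian_group B"
    and closed: "\<And>x. x \<in> carrier A \<Longrightarrow> h x \<in> carrier B"
    and add: "\<And>x y. \<lbrakk>x \<in> carrier A; y \<in> carrier A\<rbrakk> \<Longrightarrow> h (x \<oplus>\<^bsub>A\<^esub> y) = h x \<oplus>\<^bsub>B\<^esub> h y"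
  shows "abelian_group_hom A B h"
  using assms by (intro abelian_group_homI group_hom.intro group_hom_axioms.intro homI)
    (auto intro: abelian_group.a_group)

context abelian_group_hom
begin

lemma hom_finsum:
  assumes "f \<in> I \<rightarrow> carrier G"
  shows "h (\<Oplus>\<^bsub>G\<^esub>i\<in>I. f i) = (\<Oplus>\<^bsub>H\<^esub>i\<in>I. h (f i))"
  using assms by (induction I rule: infinite_finite_induct) (auto simp: Pi_iff)

lemma hom_minus:
  "\<lbrakk>x \<in> carrier G; y \<in> carrier G\<rbrakk> \<Longrightarrow> h (x \<ominus>\<^bsub>G\<^esub> y) = h x \<ominus>\<^bsub>H\<^esub> h y"
  by (simp add: G.minus_eq H.minus_eq)

end

text \<open>The additive extension of \<open>f\<close> to the free abelian group. Passing to cosets of the tensor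
relations turns it into the map of a tensor product induced by \<open>f\<close>.\<close>

abbreviation frag_sum :: "('c, 'm) ring_scheme \<Rightarrow> ('a \<Rightarrow> 'c) \<Rightarrow> ('a \<Rightarrow>\<^sub>0 int) \<Rightarrow> 'c" where
  "frag_sum B f c \<equiv> \<Oplus>\<^bsub>B\<^esub>p\<in>Poly_Mapping.keys c. [Poly_Mapping.lookup c p] \<cdot>\<^bsub>B\<^esub> f p"

context abelian_group
begin

lemma int_add_pow_closed: "x \<in> carrier G \<Longrightarrow> [(n::int)] \<cdot>\<^bsub>G\<^esub> x \<in> carrier G"
  using add.int_pow_closed[of x n] by (simp add: add_pow_def)

text \<open>The index set \<open>keys c\<close> varies with \<open>c\<close>, and cancellation makes it behave badly under addition;
sums for different \<open>c\<close> are compared over a common finite index set instead.\<close>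

lemma frag_sum_superset:
  assumes "f \<in> I \<rightarrow> carrier G" "finite I" "Poly_Mapping.keys c \<subseteq> I"
  shows "frag_sum G f c = (\<Oplus>p\<in>I. [Poly_Mapping.lookup c p] \<cdot>\<^bsub>G\<^esub> f p)"
proof (rule add.finprod_mono_neutral_cong_left)
  show "[Poly_Mapping.lookup c p] \<cdot>\<^bsub>G\<^esub> f p = \<zero>" if "p \<in> I - Poly_Mapping.keys c" for p
    using that by (simp add: in_keys_iff add_pow_def)
qed (use assms in \<open>auto intro!: int_add_pow_closed\<close>)

lemma frag_sum_closed:
  assumes "f \<in> S \<rightarrow> carrier G" "Poly_Mapping.keys c \<subseteq> S"
  shows "frag_sum G f c \<in> carrier G"
  using assms by (intro finsum_closed) (auto intro!: int_add_pow_closed)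

lemma frag_sum_of:
  assumes "f x \<in> carrier G"
  shows "frag_sum G f (frag_of x) = f x"
  using assms finsum_insert[of "{}" x "\<lambda>p. [(1::int)] \<cdot>\<^bsub>G\<^esub> f p"] add.int_pow_1[of "f x"]
  by (simp add: add_pow_def cong: finsum_cong)

lemma frag_sum_add:
  assumes f: "f \<in> S \<rightarrow> carrier G" and ab: "Poly_Mapping.keys a \<subseteq> S" "Poly_Mapping.keys b \<subseteq> S"
  shows "frag_sum G f (a + b) = frag_sum G f a \<oplus> frag_sum G f b"
proof -
  let ?I = "Poly_Mapping.keys a \<union> Poly_Mapping.keys b"
  have fI: "f \<in> ?I \<rightarrow> carrier G"
    using f ab by auto
  have pw: "add_pow G (m + n) (f p) = add_pow G m (f p) \<oplus> add_pow G n (f p)" if "p \<in> ?I" for p and m n :: int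
  proof -
    have "f p \<in> carrier G" using fI that by auto
    then show ?thesis
      using add.int_pow_mult[of "f p" m n] by (simp add: add_pow_def)
  qed
  have "frag_sum G f (a + b) = (\<Oplus>p\<in>?I. [Poly_Mapping.lookup (a + b) p] \<cdot>\<^bsub>G\<^esub> f p)"
    using fI keys_add[of a b] by (intro frag_sum_superset) auto
  also have "\<dots> = (\<Oplus>p\<in>?I. [Poly_Mapping.lookup a p] \<cdot>\<^bsub>G\<^esub> f p \<oplus> [Poly_Mapping.lookup b p] \<cdot>\<^bsub>G\<^esub> f p)"
    using fI by (intro finsum_cong') (auto simp: lookup_add pw intro!: int_add_pow_closed)
  also have "\<dots> = (\<Oplus>p\<in>?I. [Poly_Mapping.lookup a p] \<cdot>\<^bsub>G\<^esub> f p) \<oplus> (\<Oplus>p\<in>?I. [Poly_Mapping.lookup b p] \<cdot>\<^bsub>G\<^esub> f p)"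
    using fI by (intro finsum_addf) (auto intro!: int_add_pow_closed)
  also have "\<dots> = frag_sum G f a \<oplus> frag_sum G f b"
    using fI by (simp add: frag_sum_superset[of f ?I])
  finally show ?thesis .
qed

lemma frag_sum_diff:
  assumes f: "f \<in> S \<rightarrow> carrier G" and ab: "Poly_Mapping.keys a \<subseteq> S" "Poly_Mapping.keys b \<subseteq> S"
  shows "frag_sum G f (a - b) = frag_sum G f a \<ominus> frag_sum G f b"
proof -
  have k: "Poly_Mapping.keys (a - b) \<subseteq> S"
    using ab keys_diff[of a b] by blast
  have c: "frag_sum G f a \<in> carrier G" "frag_sum G f b \<in> carrier G" "frag_sum G f (a - b) \<in> carrier G"
    using frag_sum_closed[OF f] ab k by auto
  have "frag_sum G f a = frag_sum G f (a - b) \<oplus> frag_sum G f b"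
    using frag_sum_add[OF f k ab(2)] by simp
  then have "frag_sum G f a \<ominus> frag_sum G f b = frag_sum G f (a - b) \<oplus> (frag_sum G f b \<oplus> \<ominus> frag_sum G f b)"
    using c by (simp only: minus_eq a_assoc a_inv_closed)
  then show ?thesis
    using c by (simp add: r_neg)
qed

end

lemma keys_frag_map:
  assumes "\<And>p. p \<in> S \<Longrightarrow> h p \<in> S'" "Poly_Mapping.keys c \<subseteq> S"
  shows "Poly_Mapping.keys (frag_extend (\<lambda>p. frag_of (h p)) c) \<subseteq> S'"
  using keys_frag_extend[of "\<lambda>p. frag_of (h p)" c] assms by auto

section \<open>Maps out of tensor products\<close>

text \<open>Every element of a tensor product is the class of a formal combination of pairs, so the
operations of the tensor product are computed here on representatives.\<close>

context
  fixes M :: "('s, 't, 'a, 'm) bimod_scheme" and N :: "('t, 'v, 'b, 'n) bimod_scheme"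
    and T :: "('t, 'l) ring_scheme" and S :: "('s, 'k) ring_scheme" and V :: "('v, 'j) ring_scheme"
  assumes M: "bimodule S T M" and N: "bimodule T V N"
begin

interpretation M: bimodule S T M by (rule M)
interpretation N: bimodule T V N by (rule N)
interpretation F: comm_group "tensor_free M N" by (rule abelian_free_Abelian_group)

lemma tensor_relations_subset: "tensor_relations T M N \<subseteq> carrier (tensor_free M N)"
proof -
  have d: "a - b \<in> carrier (tensor_free M N)"
    if "a \<in> carrier (tensor_free M N)" "b \<in> carrier (tensor_free M N)" for a b
    using that keys_diff[of a b] by auto
  show ?thesis
    unfolding tensor_relations_def
    by (auto intro!: d simp del: carrier_free_Abelian_group_iff
        simp: M.ract_closed N.lact_closed)
qed

lemma tensor_kernel_subgroup: "subgroup (tensor_kernel T M N) (tensor_free M N)"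
  unfolding tensor_kernel_def by (rule F.generate_is_subgroup[OF tensor_relations_subset])

lemma tensor_kernel_normal: "normal (tensor_kernel T M N) (tensor_free M N)"
  using tensor_kernel_subgroup by (simp add: F.normal_iff_subgroup)

lemma tensor_kernel_keys: "k \<in> tensor_kernel T M N \<Longrightarrow> Poly_Mapping.keys k \<subseteq> carrier M \<times> carrier N"
  using subgroup.subset[OF tensor_kernel_subgroup] by fastforce

lemma mem_tensor_class_iff:
  "c' \<in> tensor_class T M N c \<longleftrightarrow> (\<exists>k\<in>tensor_kernel T M N. c' = k + c)"
  by (simp add: tensor_class_def r_coset_def)

lemma carrier_tensor:
  "carrier (tensor T M N) = tensor_class T M N ` {c. Poly_Mapping.keys c \<subseteq> carrier M \<times> carrier N}"
  by (auto simp: tensor_def FactGroup_def RCOSETS_def tensor_class_def)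

lemma add_tensor_class:
  assumes "Poly_Mapping.keys a \<subseteq> carrier M \<times> carrier N" "Poly_Mapping.keys b \<subseteq> carrier M \<times> carrier N"
  shows "tensor_class T M N a \<oplus>\<^bsub>tensor T M N\<^esub> tensor_class T M N b = tensor_class T M N (a + b)"
  using normal.rcos_sum[OF tensor_kernel_normal, of a b] assms
  by (simp add: tensor_def FactGroup_def tensor_class_def)

text \<open>The actions on a tensor product and the induced maps are obtained by applying a map \<open>h\<close> of formal
combinations to a whole coset. Invariance of \<open>h\<close> under the kernel makes the result a singleton.\<close>

lemma the_elem_tensor_class:
  assumes "\<And>k. k \<in> tensor_kernel T M N \<Longrightarrow> h (k + c) = h c"
  shows "the_elem (h ` tensor_class T M N c) = h c"
proof -
  have "0 \<in> tensor_kernel T M N"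
    using subgroup.one_closed[OF tensor_kernel_subgroup] by simp
  then have "h ` tensor_class T M N c = {h c}"
    using assms by (force simp: mem_tensor_class_iff)
  then show ?thesis by simp
qed

text \<open>The generators of the kernel and their negatives are enough, since the kernel is closed under sums.\<close>

lemma tensor_kernel_induct [consumes 1, case_names zero rel minus add]:
  assumes "k \<in> tensor_kernel T M N"
    and "P 0" "\<And>r. r \<in> tensor_relations T M N \<Longrightarrow> P r"
    and "\<And>r. r \<in> tensor_relations T M N \<Longrightarrow> P (- r)"
    and "\<And>a b. \<lbrakk>a \<in> tensor_kernel T M N; b \<in> tensor_kernel T M N; P a; P b\<rbrakk> \<Longrightarrow> P (a + b)"
  shows "P k"
  using assms(1) unfolding tensor_kernel_def
proof (induction rule: generate.induct)
  case (inv h)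
  then have "Poly_Mapping.keys h \<subseteq> carrier M \<times> carrier N"
    using tensor_relations_subset by fastforce
  then show ?case using assms(4) inv by simp
next
  case (eng h1 h2)
  then show ?case using assms(5) unfolding tensor_kernel_def by simp
qed (use assms in auto)

lemma tensor_class_kernel_add:
  assumes "k \<in> tensor_kernel T M N" "Poly_Mapping.keys c \<subseteq> carrier M \<times> carrier N"
  shows "tensor_class T M N (k + c) = tensor_class T M N c"
proof -
  have "k + c \<in> tensor_class T M N c"
    using assms by (auto simp: mem_tensor_class_iff)
  then show ?thesis
    using F.repr_independence[OF _ _ tensor_kernel_subgroup, of "k + c" c] assms
    by (simp add: tensor_class_def)
qed

text \<open>A map of pairs that sends defining relations to defining relations extends additively to a
map that preserves the kernel, and so descends to classes.\<close>

lemma induced_tensor_class: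
  assumes h: "\<And>p. p \<in> carrier M \<times> carrier N \<Longrightarrow> h p \<in> carrier M \<times> carrier N"
    and rel: "\<And>r. r \<in> tensor_relations T M N \<Longrightarrow>
      frag_extend (\<lambda>p. frag_of (h p)) r \<in> tensor_relations T M N"
    and c: "Poly_Mapping.keys c \<subseteq> carrier M \<times> carrier N"
  shows "the_elem ((\<lambda>c. tensor_class T M N (frag_extend (\<lambda>p. frag_of (h p)) c)) ` tensor_class T M N c)
    = tensor_class T M N (frag_extend (\<lambda>p. frag_of (h p)) c)"
proof (rule the_elem_tensor_class)
  fix k assume k: "k \<in> tensor_kernel T M N"
  let ?E = "frag_extend (\<lambda>p. frag_of (h p))"
  have "?E k \<in> tensor_kernel T M N"
    using k
  proof (induction rule: tensor_kernel_induct)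
    case zero
    show ?case
      using subgroup.one_closed[OF tensor_kernel_subgroup] by simp
  next
    case (rel r)
    then show ?case
      using assms(2) unfolding tensor_kernel_def by (intro generate.incl)
  next
    case (minus r)
    then have "?E r \<in> tensor_relations T M N" by (rule rel)
    moreover from this have "Poly_Mapping.keys (?E r) \<subseteq> carrier M \<times> carrier N"
      using tensor_relations_subset by fastforce
    ultimately show ?case
      using generate.inv[of "?E r" "tensor_relations T M N" "tensor_free M N"]
      unfolding tensor_kernel_def by (simp add: frag_extend_minus)
  next
    case (add a b)
    then show ?case
      using subgroup.m_closed[OF tensor_kernel_subgroup, of "?E a" "?E b"]
      by (simp add: frag_extend_add)
  qed
  then show "tensor_class T M N (?E (k + c)) = tensor_class T M N (?E c)"
    using keys_frag_map[OF h c] by (simp add: frag_extend_add tensor_class_kernel_add)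
qed

text \<open>The balancing relation survives the left action because the two actions on \<open>M\<close> commute.\<close>

lemma lact_tensor_class:
  assumes s: "s \<in> carrier S" and c: "Poly_Mapping.keys c \<subseteq> carrier M \<times> carrier N"
  shows "lact (tensor T M N) s (tensor_class T M N c)
    = tensor_class T M N (frag_extend (\<lambda>(x, y). frag_of (lact M s x, y)) c)"
proof -
  define h where "h = (\<lambda>(x :: 'a, y :: 'b). (lact M s x, y))"
  have hE: "(\<lambda>(x, y). frag_of (lact M s x, y)) = (\<lambda>p. frag_of (h p))"
    by (auto simp: h_def)
  have "frag_extend (\<lambda>p. frag_of (h p)) r \<in> tensor_relations T M N"
    if "r \<in> tensor_relations T M N" for r
    using that unfolding tensor_relations_def
    apply (elim UnE CollectE exE conjE)
      apply (simp_all add: frag_extend_diff h_def M.lact_add[OF s] M.lact_ract[OF s, symmetric])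
    using M.lact_closed[OF s] by blast+
  then have "the_elem ((\<lambda>c. tensor_class T M N (frag_extend (\<lambda>p. frag_of (h p)) c)) ` tensor_class T M N c)
    = tensor_class T M N (frag_extend (\<lambda>p. frag_of (h p)) c)"
    by (intro induced_tensor_class c) (auto simp: h_def M.lact_closed s)
  then show ?thesis
    by (simp add: tensor_def hE)
qed

lemma ract_tensor_class:
  assumes v: "v \<in> carrier V" and c: "Poly_Mapping.keys c \<subseteq> carrier M \<times> carrier N"
  shows "ract (tensor T M N) (tensor_class T M N c) v
    = tensor_class T M N (frag_extend (\<lambda>(x, y). frag_of (x, ract N y v)) c)"
proof -
  define h where "h = (\<lambda>(x :: 'a, y :: 'b). (x, ract N y v))"
  have hE: "(\<lambda>(x, y). frag_of (x, ract N y v)) = (\<lambda>p. frag_of (h p))"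
    by (auto simp: h_def)
  have "frag_extend (\<lambda>p. frag_of (h p)) r \<in> tensor_relations T M N"
    if "r \<in> tensor_relations T M N" for r
    using that unfolding tensor_relations_def
    apply (elim UnE CollectE exE conjE)
      apply (simp_all add: frag_extend_diff h_def N.ract_add[OF v] N.lact_ract[OF _ v])
    using N.ract_closed[OF v] by blast+
  then have "the_elem ((\<lambda>c. tensor_class T M N (frag_extend (\<lambda>p. frag_of (h p)) c)) ` tensor_class T M N c)
    = tensor_class T M N (frag_extend (\<lambda>p. frag_of (h p)) c)"
    by (intro induced_tensor_class c) (auto simp: h_def N.ract_closed v)
  then show ?thesis
    by (simp add: tensor_def hE)
qed

context
  fixes P :: "('s, 'v, 'p, 'q) bimod_scheme" and f :: "'a \<Rightarrow> 'b \<Rightarrow> 'p"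
  assumes P: "bimodule S V P"
    and f_closed: "\<And>x y. \<lbrakk>x \<in> carrier M; y \<in> carrier N\<rbrakk> \<Longrightarrow> f x y \<in> carrier P"
    and f_add1: "\<And>x x' y. \<lbrakk>x \<in> carrier M; x' \<in> carrier M; y \<in> carrier N\<rbrakk>
      \<Longrightarrow> f (x \<oplus>\<^bsub>M\<^esub> x') y = f x y \<oplus>\<^bsub>P\<^esub> f x' y"
    and f_add2: "\<And>x y y'. \<lbrakk>x \<in> carrier M; y \<in> carrier N; y' \<in> carrier N\<rbrakk>
      \<Longrightarrow> f x (y \<oplus>\<^bsub>N\<^esub> y') = f x y \<oplus>\<^bsub>P\<^esub> f x y'"
    and f_bal: "\<And>x t y. \<lbrakk>x \<in> carrier M; t \<in> carrier T; y \<in> carrier N\<rbrakk>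
      \<Longrightarrow> f (ract M x t) y = f x (lact N t y)"
begin

interpretation P: bimodule S V P by (rule P)

abbreviation "tensor_sum \<equiv> frag_sum P (\<lambda>p. f (fst p) (snd p))"

lemma f_Pi: "(\<lambda>p. f (fst p) (snd p)) \<in> carrier M \<times> carrier N \<rightarrow> carrier P"
  using f_closed by auto

lemmas tensor_sum_add = P.M.frag_sum_add[OF f_Pi] and tensor_sum_diff = P.M.frag_sum_diff[OF f_Pi]
  and tensor_sum_closed = P.M.frag_sum_closed[OF f_Pi]

lemma tensor_sum_of: "\<lbrakk>x \<in> carrier M; y \<in> carrier N\<rbrakk> \<Longrightarrow> tensor_sum (frag_of (x, y)) = f x y"
  using P.M.frag_sum_of[of "\<lambda>p. f (fst p) (snd p)" "(x, y)"] f_closed by simp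

text \<open>The three families of relations vanish by additivity in the first argument, additivity in the
second, and balancedness, respectively.\<close>

lemma tensor_sum_relation:
  assumes "r \<in> tensor_relations T M N"
  shows "tensor_sum r = \<zero>\<^bsub>P\<^esub>"
proof -
  have k: "Poly_Mapping.keys (frag_of (x, y)) \<subseteq> carrier M \<times> carrier N"
    if "x \<in> carrier M" "y \<in> carrier N" for x y
    using that by simp
  have kd: "Poly_Mapping.keys (frag_of (x, y) - frag_of (x', y')) \<subseteq> carrier M \<times> carrier N"
    if "x \<in> carrier M" "y \<in> carrier N" "x' \<in> carrier M" "y' \<in> carrier N" for x y x' y'
    using that keys_diff[of "frag_of (x, y)" "frag_of (x', y')"] by auto
  have z: "(a \<oplus>\<^bsub>P\<^esub> b) \<ominus>\<^bsub>P\<^esub> a \<ominus>\<^bsub>P\<^esub> b = \<zero>\<^bsub>P\<^esub>" if "a \<in> carrier P" "b \<in> carrier P" for a b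
    using that by (metis P.M.minus_eq P.M.a_closed P.M.a_inv_closed P.M.a_assoc P.M.a_comm P.M.r_neg P.M.r_zero)
  have z0: "a \<ominus>\<^bsub>P\<^esub> a = \<zero>\<^bsub>P\<^esub>" if "a \<in> carrier P" for a
    using that by (simp add: P.M.minus_eq P.M.r_neg)
  show ?thesis
    using assms unfolding tensor_relations_def
    apply (elim UnE CollectE exE conjE)
      apply (simp_all only: tensor_sum_diff kd k M.M.a_closed N.M.a_closed tensor_sum_of f_add1 f_add2 f_bal
          M.ract_closed N.lact_closed z z0 f_closed)
    done
qed

lemma tensor_sum_kernel:
  assumes "k \<in> tensor_kernel T M N"
  shows "tensor_sum k = \<zero>\<^bsub>P\<^esub>"
  using assms
proof (induction rule: tensor_kernel_induct)
  case (minus r)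
  then have "Poly_Mapping.keys r \<subseteq> carrier M \<times> carrier N"
    using tensor_relations_subset by fastforce
  then show ?case
    using tensor_sum_diff[of 0 r] tensor_sum_relation[OF minus] by (simp add: P.M.minus_eq)
qed (simp_all add: tensor_sum_relation tensor_sum_add tensor_kernel_keys)

lemma tensor_lift_class:
  assumes "Poly_Mapping.keys c \<subseteq> carrier M \<times> carrier N"
  shows "tensor_lift P f (tensor_class T M N c) = tensor_sum c"
  unfolding tensor_lift_def
  by (rule the_elem_tensor_class)
    (simp add: assms tensor_sum_add tensor_sum_kernel tensor_kernel_keys tensor_sum_closed)

lemma tensor_lift_pure:
  "\<lbrakk>x \<in> carrier M; y \<in> carrier N\<rbrakk> \<Longrightarrow> tensor_lift P f (pure_tensor T M N x y) = f x y"
  using tensor_lift_class[of "frag_of (x, y)"] tensor_sum_of[of x y] by (simp add: pure_tensor_def)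

text \<open>A tensor product is generated as a group by its pure tensors, so an additive subgroup that contains
the values on them contains the whole image.\<close>

lemma tensor_lift_mem:
  assumes H: "additive_subgroup H P"
    and f: "\<And>x y. \<lbrakk>x \<in> carrier M; y \<in> carrier N\<rbrakk> \<Longrightarrow> f x y \<in> H"
    and C: "C \<in> carrier (tensor T M N)"
  shows "tensor_lift P f C \<in> H"
proof -
  obtain c where C': "C = tensor_class T M N c"
    and c: "Poly_Mapping.keys c \<subseteq> carrier M \<times> carrier N"
    using C by (auto simp: carrier_tensor)
  have "tensor_sum c \<in> H"
  proof (rule free_Abelian_group_induct[where P = "\<lambda>c. tensor_sum c \<in> H", OF c])
    show "tensor_sum 0 \<in> H"
      using additive_subgroup.zero_closed[OF H] by simp
  next
    fix a b
    assume "Poly_Mapping.keys a \<subseteq> carrier M \<times> carrier N" "Poly_Mapping.keys b \<subseteq> carrier M \<times> carrier N"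
      "tensor_sum a \<in> H" "tensor_sum b \<in> H"
    then show "tensor_sum (a - b) \<in> H"
      by (simp only: tensor_sum_diff P.M.minus_eq additive_subgroup.a_closed[OF H] additive_subgroup.a_inv_closed[OF H])
  next
    fix p assume p: "p \<in> carrier M \<times> carrier N"
    then show "tensor_sum (frag_of p) \<in> H"
      using tensor_sum_of[of "fst p" "snd p"] f[of "fst p" "snd p"] by (auto simp del: lookup_frag_of)
  qed
  then show ?thesis
    by (simp only: C' tensor_lift_class[OF c])
qed

context
  assumes f_lact: "\<And>s x y. \<lbrakk>s \<in> carrier S; x \<in> carrier M; y \<in> carrier N\<rbrakk>
      \<Longrightarrow> f (lact M s x) y = lact P s (f x y)"
    and f_ract: "\<And>x y v. \<lbrakk>x \<in> carrier M; y \<in> carrier N; v \<in> carrier V\<rbrakk>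
      \<Longrightarrow> f x (ract N y v) = ract P (f x y) v"
begin

text \<open>Both sides are additive in \<open>c\<close>, so agreement on pairs is enough. This transfers equivariance of
\<open>f\<close> under either action to its additive extension, with \<open>H\<close> the action of a fixed scalar on \<open>P\<close>.\<close>

lemma tensor_sum_transport:
  assumes h: "\<And>p. p \<in> carrier M \<times> carrier N \<Longrightarrow> h p \<in> carrier M \<times> carrier N"
    and H: "abelian_group_hom P P H"
    and fh: "\<And>p. p \<in> carrier M \<times> carrier N \<Longrightarrow> f (fst (h p)) (snd (h p)) = H (f (fst p) (snd p))"
    and c: "Poly_Mapping.keys c \<subseteq> carrier M \<times> carrier N"
  shows "tensor_sum (frag_extend (\<lambda>p. frag_of (h p)) c) = H (tensor_sum c)"
proof (rule free_Abelian_group_induct[where P = "\<lambda>c. tensor_sum (frag_extend (\<lambda>p. frag_of (h p)) c) = H (tensor_sum c)", OF c])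
  show "tensor_sum (frag_extend (\<lambda>p. frag_of (h p)) 0) = H (tensor_sum 0)"
    using abelian_group_hom.hom_zero[OF H] by simp
next
  fix a b
  assume "Poly_Mapping.keys a \<subseteq> carrier M \<times> carrier N" "Poly_Mapping.keys b \<subseteq> carrier M \<times> carrier N"
    "tensor_sum (frag_extend (\<lambda>p. frag_of (h p)) a) = H (tensor_sum a)"
    "tensor_sum (frag_extend (\<lambda>p. frag_of (h p)) b) = H (tensor_sum b)"
  then show "tensor_sum (frag_extend (\<lambda>p. frag_of (h p)) (a - b)) = H (tensor_sum (a - b))"
    by (simp only: frag_extend_diff tensor_sum_diff keys_frag_map[OF h] tensor_sum_closed
        abelian_group_hom.hom_minus[OF H])
next
  fix p assume "p \<in> carrier M \<times> carrier N"
  then show "tensor_sum (frag_extend (\<lambda>p. frag_of (h p)) (frag_of p)) = H (tensor_sum (frag_of p))"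
    using tensor_sum_of[of "fst p" "snd p"] tensor_sum_of[of "fst (h p)" "snd (h p)"] h[of p] fh[of p]
    by (auto simp del: lookup_frag_of simp: mem_Times_iff)
qed

lemma tensor_lift_hom: "tensor_lift P f \<in> bimod_hom S V (tensor T M N) P"
  unfolding bimod_hom_def
proof (intro CollectI conjI ballI)
  show "tensor_lift P f \<in> carrier (tensor T M N) \<rightarrow> carrier P"
    by (auto simp: carrier_tensor tensor_lift_class tensor_sum_closed)
next
  fix C C' assume "C \<in> carrier (tensor T M N)" "C' \<in> carrier (tensor T M N)"
  then obtain c c' where "C = tensor_class T M N c" "C' = tensor_class T M N c'"
    and c: "Poly_Mapping.keys c \<subseteq> carrier M \<times> carrier N" "Poly_Mapping.keys c' \<subseteq> carrier M \<times> carrier N"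
    by (auto simp: carrier_tensor)
  moreover have "Poly_Mapping.keys (c + c') \<subseteq> carrier M \<times> carrier N"
    using c keys_add[of c c'] by blast
  ultimately show "tensor_lift P f (C \<oplus>\<^bsub>tensor T M N\<^esub> C') = tensor_lift P f C \<oplus>\<^bsub>P\<^esub> tensor_lift P f C'"
    by (simp only: add_tensor_class tensor_lift_class tensor_sum_add)
next
  fix s C assume s: "s \<in> carrier S" and "C \<in> carrier (tensor T M N)"
  then obtain c where C: "C = tensor_class T M N c"
    and c: "Poly_Mapping.keys c \<subseteq> carrier M \<times> carrier N"
    by (auto simp: carrier_tensor)
  define h where "h = (\<lambda>(x :: 'a, y :: 'b). (lact M s x, y))"
  have hE: "(\<lambda>(x, y). frag_of (lact M s x, y)) = (\<lambda>p. frag_of (h p))"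
    by (auto simp: h_def)
  have h: "h p \<in> carrier M \<times> carrier N" if "p \<in> carrier M \<times> carrier N" for p
    using that s by (auto simp: h_def M.lact_closed)
  have "abelian_group_hom P P (lact P s)"
    using s by (intro abelian_group_homI_additive P.M.abelian_group_axioms) (auto simp: P.lact_closed P.lact_add)
  then have "tensor_sum (frag_extend (\<lambda>p. frag_of (h p)) c) = lact P s (tensor_sum c)"
    using s by (intro tensor_sum_transport h c) (auto simp: h_def f_lact)
  then show "tensor_lift P f (lact (tensor T M N) s C) = lact P s (tensor_lift P f C)"
    by (simp only: C lact_tensor_class[OF s c] hE tensor_lift_class c keys_frag_map[OF h c])
next
  fix v C assume v: "v \<in> carrier V" and "C \<in> carrier (tensor T M N)"
  then obtain c where C: "C = tensor_class T M N c"
    and c: "Poly_Mapping.keys c \<subseteq> carrier M \<times> carrier N"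
    by (auto simp: carrier_tensor)
  define h where "h = (\<lambda>(x :: 'a, y :: 'b). (x, ract N y v))"
  have hE: "(\<lambda>(x, y). frag_of (x, ract N y v)) = (\<lambda>p. frag_of (h p))"
    by (auto simp: h_def)
  have h: "h p \<in> carrier M \<times> carrier N" if "p \<in> carrier M \<times> carrier N" for p
    using that v by (auto simp: h_def N.ract_closed)
  have "abelian_group_hom P P (\<lambda>x. ract P x v)"
    using v by (intro abelian_group_homI_additive P.M.abelian_group_axioms) (auto simp: P.ract_closed P.ract_add)
  then have "tensor_sum (frag_extend (\<lambda>p. frag_of (h p)) c) = ract P (tensor_sum c) v"
    using v by (intro tensor_sum_transport[where H = "\<lambda>x. ract P x v"] h c) (auto simp: h_def f_ract)
  then show "tensor_lift P f (ract (tensor T M N) C v) = ract P (tensor_lift P f C) v"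
    by (simp only: C ract_tensor_class[OF v c] hE tensor_lift_class c keys_frag_map[OF h c])
qed

end

end

lemma pure_tensor_closed:
  "\<lbrakk>x \<in> carrier M; y \<in> carrier N\<rbrakk> \<Longrightarrow> pure_tensor T M N x y \<in> carrier (tensor T M N)"
  by (auto simp: pure_tensor_def carrier_tensor)

end

lemma regular_bimodule:
  assumes "ring S" shows "bimodule S S (regular_bimod S)"
proof -
  interpret ring S by (rule assms)
  have "abelian_group (regular_bimod S)"
    by (rule abelian_groupI) (auto simp: regular_bimod_def as_bimod_def a_ac intro!: bexI[of _ "\<ominus>\<^bsub>S\<^esub> x" for x] l_neg)
  then show ?thesis
    by (intro bimodule.intro bimodule_axioms.intro assms)
      (auto simp: regular_bimod_def as_bimod_def l_distr r_distr m_assoc)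
qed

text \<open>A ring and its regular bimodule are records with different fields, but an induced map only depends
on the additive structure, which they share.\<close>

lemma tensor_lift_regular_bimod: "tensor_lift (regular_bimod S) = tensor_lift S"
  by (intro ext) (simp add: tensor_lift_def finsum_def add_pow_def finprod_def int_pow_def
      nat_pow_def m_inv_def Let_def regular_bimod_def as_bimod_def cong: if_cong)

section \<open>Groupoids\<close>

context groupoid
begin

lemma composableI: "\<lbrakk>g \<in> carrier G; h \<in> carrier G; gdom G g = gran G h\<rbrakk> \<Longrightarrow> (g, h) \<in> composable G"
  by (simp add: composable_def)

lemma composableD:
  "(g, h) \<in> composable G \<Longrightarrow> g \<in> carrier G"
  "(g, h) \<in> composable G \<Longrightarrow> h \<in> carrier G"
  "(g, h) \<in> composable G \<Longrightarrow> gdom G g = gran G h"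
  by (simp_all add: composable_def)

lemma composable_ginv:
  assumes "g \<in> carrier G"
  shows "(g, ginv G g) \<in> composable G" "(ginv G g, g) \<in> composable G"
  using assms by (simp_all add: composable_def ginv_closed gran_ginv gdom_ginv)

lemma ginv_ginv:
  assumes g: "g \<in> carrier G" shows "ginv G (ginv G g) = g"
proof -
  let ?i = "ginv G g"
  have i: "?i \<in> carrier G" and ii: "ginv G ?i \<in> carrier G"
    using g by (simp_all add: ginv_closed)
  have "ginv G ?i = gcomp G (ginv G ?i) (gcomp G ?i g)"
    using gcomp_gdom[OF ii] gdom_ginv[OF i] gran_ginv[OF g] by (simp add: gdom_def)
  also have "\<dots> = gcomp G (gcomp G (ginv G ?i) ?i) g"
    using composable_ginv[OF g] composable_ginv[OF i] by (simp add: gcomp_assoc)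
  also have "\<dots> = gcomp G (gran G g) g"
    using gdom_ginv[OF g] by (simp add: gdom_def)
  finally show ?thesis
    using gran_gcomp_self[OF g] by simp
qed

lemma gdom_identity: "g \<in> carrier G \<Longrightarrow> gdom G g \<in> identities G"
  by (simp add: identities_def)

lemma gran_identity: "g \<in> carrier G \<Longrightarrow> gran G g \<in> identities G"
  using gdom_identity[of "ginv G g"] by (simp add: ginv_closed gdom_ginv)

lemma identity_closed: "e \<in> identities G \<Longrightarrow> e \<in> carrier G"
  by (auto simp: identities_def gdom_def intro!: gcomp_closed composable_ginv)

lemma gdom_of_identity: "e \<in> identities G \<Longrightarrow> gdom G e = e"
  unfolding identities_def using composable_ginv(2) gdom_gcomp by (auto simp: gdom_def)

lemma gran_of_identity: "e \<in> identities G \<Longrightarrow> gran G e = e"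
proof -
  assume "e \<in> identities G"
  then obtain g where g: "g \<in> carrier G" "e = gdom G g"
    by (auto simp: identities_def)
  then have "gran G e = gran G (ginv G g)"
    using gran_gcomp[OF composable_ginv(2)[OF g(1)]] by (simp add: gdom_def)
  then show ?thesis
    using g by (simp add: gran_ginv)
qed

lemma ginv_of_identity: "e \<in> identities G \<Longrightarrow> ginv G e = e"
  using gcomp_gdom[of "ginv G e"] gdom_ginv[of e] ginv_closed[of e] gdom_of_identity[of e]
    gran_of_identity[of e] identity_closed[of e]
  by (metis gdom_def)

lemma gcomp_ginv_cancel_left:
  "(g, h) \<in> composable G \<Longrightarrow> gcomp G (ginv G g) (gcomp G g h) = h"
  using gcomp_assoc[of "ginv G g" g h] composable_ginv(2)[of g] gran_gcomp_self[of h]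
  by (simp add: composableD gdom_def[symmetric])

lemma gcomp_ginv_cancel_right:
  "(g, h) \<in> composable G \<Longrightarrow> gcomp G (gcomp G g h) (ginv G h) = g"
  using gcomp_assoc[of g h "ginv G h"] composable_ginv(1)[of h] gcomp_gdom[of g]
  by (simp add: composableD gran_def[symmetric] del: composable_ginv)

lemma composable_ginv_left:
  "\<lbrakk>g \<in> carrier G; k \<in> carrier G; gran G g = gran G k\<rbrakk> \<Longrightarrow> (ginv G g, k) \<in> composable G"
  by (simp add: composable_def ginv_closed gdom_ginv)

lemma composable_ginv_right:
  "\<lbrakk>h \<in> carrier G; k \<in> carrier G; gdom G h = gdom G k\<rbrakk> \<Longrightarrow> (k, ginv G h) \<in> composable G"
  by (simp add: composable_def ginv_closed gran_ginv)

lemma gcomp_ginv_cancel_left':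
  "\<lbrakk>g \<in> carrier G; k \<in> carrier G; gran G g = gran G k\<rbrakk> \<Longrightarrow> gcomp G g (gcomp G (ginv G g) k) = k"
  using gcomp_ginv_cancel_left[OF composable_ginv_left] by (simp add: ginv_ginv)

lemma gcomp_ginv_cancel_right':
  "\<lbrakk>h \<in> carrier G; k \<in> carrier G; gdom G h = gdom G k\<rbrakk> \<Longrightarrow> gcomp G (gcomp G k (ginv G h)) h = k"
  using gcomp_ginv_cancel_right[OF composable_ginv_right] by (simp add: ginv_ginv)

lemma composable_inverses: "(g, h) \<in> composable G \<Longrightarrow> (ginv G h, ginv G g) \<in> composable G"
  by (simp add: composable_def ginv_closed gran_ginv gdom_ginv)

text \<open>Cancel first \<open>h\<close> and then \<open>g\<close> on the right of \<open>(gh)\<^sup>-\<^sup>1 (gh) = d(h)\<close>.\<close>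

lemma ginv_gcomp:
  assumes gh: "(g, h) \<in> composable G"
  shows "ginv G (gcomp G g h) = gcomp G (ginv G h) (ginv G g)"
proof -
  let ?k = "gcomp G g h"
  have k: "?k \<in> carrier G" "gran G ?k = gran G g" "gdom G ?k = gdom G h"
    using gh by (auto simp: gcomp_closed gran_gcomp gdom_gcomp)
  have g: "g \<in> carrier G" and h: "h \<in> carrier G"
    using gh by (auto dest: composableD)
  have c: "(ginv G ?k, g) \<in> composable G"
    using composable_ginv_left[OF k(1) g k(2)] .
  have "gcomp G (gcomp G (ginv G ?k) g) h = gdom G h"
    using gcomp_assoc[OF c gh] k(3) by (simp add: gdom_def)
  moreover have ch: "(gcomp G (ginv G ?k) g, h) \<in> composable G"
    using c gh by (intro composableI gcomp_closed) (auto simp: gdom_gcomp dest: composableD)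
  ultimately have "gcomp G (ginv G ?k) g = gcomp G (gdom G h) (ginv G h)"
    using gcomp_ginv_cancel_right[OF ch] by simp
  then have "gcomp G (ginv G ?k) g = ginv G h"
    using gran_gcomp_self[of "ginv G h"] h by (simp add: ginv_closed gran_ginv)
  then show ?thesis
    using gcomp_ginv_cancel_right[OF c] by simp
qed

end

section \<open>Finite sums in rings without identity\<close>

context nonunital_ring
begin

lemma mult_right_hom: "a \<in> carrier R \<Longrightarrow> abelian_group_hom R R (\<lambda>x. x \<otimes> a)"
  by (intro abelian_group_homI_additive abelian_group_axioms) (auto simp: m_closed l_distr)

lemma mult_left_hom: "a \<in> carrier R \<Longrightarrow> abelian_group_hom R R (\<lambda>x. a \<otimes> x)"
  by (intro abelian_group_homI_additive abelian_group_axioms) (auto simp: m_closed r_distr)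

lemma l_null: "a \<in> carrier R \<Longrightarrow> \<zero> \<otimes> a = \<zero>"
  by (rule abelian_group_hom.hom_zero[OF mult_right_hom])

lemma r_null: "a \<in> carrier R \<Longrightarrow> a \<otimes> \<zero> = \<zero>"
  by (rule abelian_group_hom.hom_zero[OF mult_left_hom])

lemma l_minus: "\<lbrakk>x \<in> carrier R; a \<in> carrier R\<rbrakk> \<Longrightarrow> (\<ominus> x) \<otimes> a = \<ominus> (x \<otimes> a)"
  by (rule abelian_group_hom.hom_a_inv[OF mult_right_hom])

lemma finsum_eq_add:
  assumes "f \<in> I \<rightarrow> carrier R" "g \<in> I \<rightarrow> carrier R" "\<And>i. i \<in> I \<Longrightarrow> h i = f i \<oplus> g i"
  shows "(\<Oplus>i\<in>I. h i) = (\<Oplus>i\<in>I. f i) \<oplus> (\<Oplus>i\<in>I. g i)"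
proof -
  have "(\<Oplus>i\<in>I. h i) = (\<Oplus>i\<in>I. f i \<oplus> g i)"
    using assms by (intro finsum_cong') auto
  then show ?thesis
    using assms by (simp add: finsum_addf)
qed

lemma finsum_single:
  assumes "finite I" "i \<in> I" "f i \<in> carrier R" "\<And>j. \<lbrakk>j \<in> I; j \<noteq> i\<rbrakk> \<Longrightarrow> f j = \<zero>"
  shows "(\<Oplus>j\<in>I. f j) = f i"
proof -
  have "(\<Oplus>j\<in>I. f j) = (\<Oplus>j\<in>{i}. f j)"
    using assms by (intro add.finprod_mono_neutral_cong_right) (auto, metis zero_closed)
  then show ?thesis
    using assms(3) by (simp add: finsum_insert finsum_empty)
qed

end

section \<open>Partial actions on ideals with identity\<close>

locale unital_partial_action = partial_action G R D \<alpha>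
  for G :: "('g, 'k) gpd_scheme" and R :: "('a, 'm) ring_scheme" (structure)
    and D :: "'g \<Rightarrow> 'a set" and \<alpha> :: "'g \<Rightarrow> 'a \<Rightarrow> 'a" +
  fixes u :: "'g \<Rightarrow> 'a"
  assumes finite_groupoid: "finite (carrier G)"
    and D_identity: "g \<in> carrier G \<Longrightarrow> is_identity R (D g) (u g)"
    and direct_sum: "internal_direct_sum R (identities G) D"
begin

lemma u_in_D: "g \<in> carrier G \<Longrightarrow> u g \<in> D g"
  using D_identity by (simp add: is_identity_def)

lemma D_subset_gran: "g \<in> carrier G \<Longrightarrow> D g \<subseteq> D (gran G g)"
  using additive_subgroup.a_subset[OF nonunital_ideal.axioms(2)[OF D_ideal]] by simp

lemma D_subset: "g \<in> carrier G \<Longrightarrow> D g \<subseteq> carrier R"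
  using D_subset_gran additive_subgroup.a_subset[OF nonunital_ideal.axioms(2)[OF D_gran_ideal]] by blast

lemma u_closed: "g \<in> carrier G \<Longrightarrow> u g \<in> carrier R"
  using u_in_D D_subset by blast

lemma D_unit_left: "\<lbrakk>g \<in> carrier G; x \<in> D g\<rbrakk> \<Longrightarrow> u g \<otimes> x = x"
  and D_unit_right: "\<lbrakk>g \<in> carrier G; x \<in> D g\<rbrakk> \<Longrightarrow> x \<otimes> u g = x"
  using D_identity by (simp_all add: is_identity_def)

text \<open>An ideal of an ideal is in general not an ideal of the whole ring. Here it is, because of the
identity: \<open>x a = (x 1\<^sub>g) a\<close>, and \<open>x 1\<^sub>g\<close> lies in the ring of which \<open>D g\<close> is an ideal.\<close>

lemma D_mult_left:
  assumes g: "g \<in> carrier G" and a: "a \<in> D g" and x: "x \<in> carrier R"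
  shows "x \<otimes> a \<in> D g"
proof -
  have "x \<otimes> u g \<in> D (gran G g)"
    using nonunital_ideal.I_l_closed[OF D_gran_ideal[OF g], of "u g" x] u_in_D[OF g] D_subset_gran[OF g] x by blast
  then have "(x \<otimes> u g) \<otimes> a \<in> D g"
    using nonunital_ideal.I_l_closed[OF D_ideal[OF g], of a "x \<otimes> u g"] a by simp
  then show ?thesis
    using a x g D_subset[OF g] by (simp add: m_assoc u_closed D_unit_left subset_iff)
qed

lemma D_mult_right:
  assumes g: "g \<in> carrier G" and a: "a \<in> D g" and x: "x \<in> carrier R"
  shows "a \<otimes> x \<in> D g"
proof -
  have "u g \<otimes> x \<in> D (gran G g)"
    using nonunital_ideal.I_r_closed[OF D_gran_ideal[OF g], of "u g" x] u_in_D[OF g] D_subset_gran[OF g] x by blast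
  then have "a \<otimes> (u g \<otimes> x) \<in> D g"
    using nonunital_ideal.I_r_closed[OF D_ideal[OF g], of a "u g \<otimes> x"] a by simp
  then show ?thesis
    using a x g D_subset[OF g] by (simp add: m_assoc[symmetric] u_closed D_unit_right subset_iff)
qed

text \<open>Both products lie in \<open>D g\<close>, so both are equal to \<open>1\<^sub>g x 1\<^sub>g\<close>.\<close>

lemma u_central:
  assumes g: "g \<in> carrier G" and x: "x \<in> carrier R"
  shows "u g \<otimes> x = x \<otimes> u g"
proof -
  have "u g \<otimes> x = (u g \<otimes> x) \<otimes> u g" "x \<otimes> u g = u g \<otimes> (x \<otimes> u g)"
    using g x by (simp_all add: D_unit_left D_unit_right D_mult_left D_mult_right u_in_D)
  then show ?thesis
    using g x by (simp add: m_assoc u_closed)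
qed

text \<open>This equational description of \<open>D g\<close> makes all closure properties of the ideal immediate.\<close>

lemma D_iff: "g \<in> carrier G \<Longrightarrow> x \<in> D g \<longleftrightarrow> x \<in> carrier R \<and> x \<otimes> u g = x"
  using D_subset D_unit_right D_mult_left[OF _ u_in_D] by (metis subsetD)

lemma u_idem: "g \<in> carrier G \<Longrightarrow> u g \<otimes> u g = u g"
  using D_unit_left u_in_D by blast

lemma u_gran: "g \<in> carrier G \<Longrightarrow> u g \<otimes> u (gran G g) = u g"
  using u_in_D[of g] D_subset_gran[of g] D_unit_right[of "gran G g"] gran_identity identity_closed by blast

lemma D_closed: "\<lbrakk>g \<in> carrier G; x \<in> D g\<rbrakk> \<Longrightarrow> x \<in> carrier R"
  using D_subset by blast

lemma D_zero: "g \<in> carrier G \<Longrightarrow> \<zero> \<in> D g"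
  by (simp add: D_iff l_null u_closed)

lemma D_add: "\<lbrakk>g \<in> carrier G; x \<in> D g; y \<in> D g\<rbrakk> \<Longrightarrow> x \<oplus> y \<in> D g"
  by (simp add: D_iff l_distr u_closed)

lemma D_minus: "\<lbrakk>g \<in> carrier G; x \<in> D g\<rbrakk> \<Longrightarrow> \<ominus> x \<in> D g"
  by (simp add: D_iff l_minus u_closed)

lemma finite_identities: "finite (identities G)"
  using finite_groupoid identity_closed by (meson finite_subset subsetI)

text \<open>A common element would have two decompositions in the direct sum, one concentrated at \<open>e\<close> and
one at \<open>f\<close>.\<close>

lemma D_identities_Int:
  assumes e: "e \<in> identities G" and f: "f \<in> identities G" and ef: "e \<noteq> f"
    and x: "x \<in> D e" "x \<in> D f"
  shows "x = \<zero>"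
proof -
  let ?E = "identities G"
  define s where "s i = (\<lambda>j\<in>?E. if j = i then x else \<zero>)" for i
  have xR: "x \<in> carrier R"
    using D_closed[OF identity_closed[OF e] x(1)] .
  have "s i \<in> (\<Pi>\<^sub>E j\<in>?E. D j) \<and> x = (\<Oplus>j\<in>?E. s i j)" if "i \<in> ?E" "x \<in> D i" for i
  proof
    show "s i \<in> (\<Pi>\<^sub>E j\<in>?E. D j)"
      using that by (auto simp: s_def D_zero identity_closed)
    have "(\<Oplus>j\<in>?E. s i j) = s i i"
      using that xR by (intro finsum_single finite_identities) (auto simp: s_def)
    then show "x = (\<Oplus>j\<in>?E. s i j)"
      using that by (simp add: s_def)
  qed
  then have "s e = s f"
    using direct_sum xR e f x unfolding internal_direct_sum_def by metis
  then have "s e e = s f e" by simp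
  then show ?thesis
    using e ef by (simp add: s_def)
qed

lemma D_orthogonal:
  assumes g: "g \<in> carrier G" and h: "h \<in> carrier G" and ne: "gran G g \<noteq> gran G h"
    and x: "x \<in> D g" and y: "y \<in> D h"
  shows "x \<otimes> y = \<zero>"
proof (rule D_identities_Int)
  note xy = D_closed[OF g x] D_closed[OF h y]
  have gr: "gran G g \<in> carrier G" "gran G h \<in> carrier G"
    using g h gran_identity identity_closed by auto
  show "x \<otimes> y \<in> D (gran G g)" "x \<otimes> y \<in> D (gran G h)"
    using D_subset_gran[OF g] D_subset_gran[OF h] x y xy gr by (auto intro: D_mult_left D_mult_right)
qed (use g h ne gran_identity in auto)

abbreviation unity_R :: 'a where "unity_R \<equiv> unity G R u"

lemma unity_closed: "unity_R \<in> carrier R"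
  unfolding unity_def by (intro finsum_closed) (auto intro: u_closed identity_closed)

text \<open>By orthogonality, on the summand \<open>D e\<close> multiplication by \<open>\<Sum>e. 1\<^sub>e\<close> is multiplication by \<open>1\<^sub>e\<close>.\<close>

lemma unity_right:
  assumes x: "x \<in> carrier R" shows "x \<otimes> unity_R = x"
proof -
  let ?E = "identities G"
  obtain f where f: "f \<in> (\<Pi>\<^sub>E e\<in>?E. D e)" and xf: "x = (\<Oplus>e\<in>?E. f e)"
    using direct_sum x unfolding internal_direct_sum_def by metis
  have fe: "f e \<in> D e" "f e \<in> carrier R" if "e \<in> ?E" for e
    using that f D_subset identity_closed by blast+
  have "f e \<otimes> unity_R = f e" if e: "e \<in> ?E" for e
  proof -
    have "f e \<otimes> unity_R = (\<Oplus>e'\<in>?E. f e \<otimes> u e')"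
      unfolding unity_def
      using fe[OF e] by (intro abelian_group_hom.hom_finsum[OF mult_left_hom]) (auto intro: u_closed identity_closed)
    also have "\<dots> = f e \<otimes> u e"
      using fe[OF e] e by (intro finsum_single finite_identities)
        (auto intro!: m_closed intro: D_orthogonal[OF identity_closed identity_closed]
          simp: u_in_D u_closed identity_closed gran_of_identity)
    finally show ?thesis
      using fe[OF e] e by (simp add: D_unit_right identity_closed)
  qed
  moreover have "x \<otimes> unity_R = (\<Oplus>e\<in>?E. f e \<otimes> unity_R)"
    unfolding xf using fe by (intro abelian_group_hom.hom_finsum[OF mult_right_hom] unity_closed) auto
  ultimately show ?thesis
    using fe xf by (metis (no_types, lifting) finsum_cong' Pi_I)
qed

lemma unity_left:
  assumes x: "x \<in> carrier R" shows "unity_R \<otimes> x = x"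
proof -
  have uc: "u e \<in> carrier R" if "e \<in> identities G" for e
    using that by (simp add: u_closed identity_closed)
  have "unity_R \<otimes> x = (\<Oplus>e\<in>identities G. u e \<otimes> x)"
    unfolding unity_def using x uc by (intro abelian_group_hom.hom_finsum[OF mult_right_hom]) auto
  also have "\<dots> = (\<Oplus>e\<in>identities G. x \<otimes> u e)"
    using x uc by (intro finsum_cong') (auto simp: u_central identity_closed m_closed)
  also have "\<dots> = x \<otimes> unity_R"
    unfolding unity_def using x uc by (intro abelian_group_hom.hom_finsum[OF mult_left_hom, symmetric]) auto
  finally show ?thesis
    using x by (simp add: unity_right)
qed

lemma \<alpha>_closed: "\<lbrakk>g \<in> carrier G; x \<in> D (ginv G g)\<rbrakk> \<Longrightarrow> \<alpha> g x \<in> D g"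
  using \<alpha>_iso[of g] by (auto simp: nonunital_ring_iso_def bij_betw_def)

lemma \<alpha>_add: "\<lbrakk>g \<in> carrier G; x \<in> D (ginv G g); y \<in> D (ginv G g)\<rbrakk> \<Longrightarrow> \<alpha> g (x \<oplus> y) = \<alpha> g x \<oplus> \<alpha> g y"
  using \<alpha>_iso[of g] by (auto simp: nonunital_ring_iso_def)

lemma \<alpha>_mult: "\<lbrakk>g \<in> carrier G; x \<in> D (ginv G g); y \<in> D (ginv G g)\<rbrakk> \<Longrightarrow> \<alpha> g (x \<otimes> y) = \<alpha> g x \<otimes> \<alpha> g y"
  using \<alpha>_iso[of g] by (auto simp: nonunital_ring_iso_def)

lemma \<alpha>_\<alpha>_inverse:
  assumes g: "g \<in> carrier G" and y: "y \<in> D g"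
  shows "\<alpha> g (\<alpha> (ginv G g) y) = y"
proof -
  have y': "y \<in> D (ginv G (ginv G g))" and c: "\<alpha> (ginv G g) y \<in> D (ginv G g)"
    using \<alpha>_closed[of "ginv G g" y] y g by (simp_all add: ginv_ginv ginv_closed)
  then have "\<alpha> g (\<alpha> (ginv G g) y) = \<alpha> (gran G g) y"
    using \<alpha>_comp[OF composable_ginv(1)[OF g] y'] by (simp add: gran_def)
  then show ?thesis
    using \<alpha>_identity[OF gran_identity[OF g]] y D_subset_gran[OF g] by auto
qed

text \<open>The axioms speak of the preimage \<open>\<alpha>\<^sub>h\<^sup>-\<^sup>1(D\<^bsub>g\<^sup>-\<^sup>1\<^esub> \<inter> D\<^sub>h)\<close>; writing an element of \<open>D\<^bsub>g\<^sup>-\<^sup>1\<^esub> \<inter> D\<^sub>h\<close> as \<open>\<alpha> h x\<close> turns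
them into a statement on the image under \<open>\<alpha> g\<close>.\<close>

lemma \<alpha>_Int:
  assumes gh: "(g, h) \<in> composable G" and y: "y \<in> D (ginv G g)" "y \<in> D h"
  shows "\<alpha> g y \<in> D (gcomp G g h)"
proof -
  note c = composableD[OF gh]
  let ?x = "\<alpha> (ginv G h) y"
  have x: "?x \<in> D (ginv G h)" and hx: "\<alpha> h ?x = y"
    using \<alpha>_closed[of "ginv G h" y] y c by (simp_all add: ginv_ginv ginv_closed \<alpha>_\<alpha>_inverse)
  have "?x \<in> D (ginv G (gcomp G g h))"
    using \<alpha>_domain[OF gh] x y hx by auto
  moreover have "\<alpha> g y = \<alpha> (gcomp G g h) ?x"
    using \<alpha>_comp[OF gh x] y hx by simp
  ultimately show ?thesis
    using \<alpha>_closed[OF gcomp_closed[OF gh]] by simp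
qed

text \<open>Applying \<open>\<alpha>_Int\<close> to \<open>g\<close> and to \<open>g\<^sup>-\<^sup>1\<close>, one sees that \<open>\<alpha> g\<close> maps \<open>D\<^bsub>g\<^sup>-\<^sup>1\<^esub> \<inter> D\<^sub>h\<close> onto
\<open>D\<^sub>g \<inter> D\<^bsub>gh\<^esub>\<close>. The two sides are the image of the identity of the first ideal and the identity of the
second.\<close>

lemma \<alpha>_u_u:
  assumes gh: "(g, h) \<in> composable G"
  shows "\<alpha> g (u (ginv G g) \<otimes> u h) = u g \<otimes> u (gcomp G g h)"
proof -
  note c = composableD[OF gh]
  let ?k = "gcomp G g h" and ?i = "ginv G g"
  have k: "?k \<in> carrier G" and i: "?i \<in> carrier G"
    using gh c by (simp_all add: gcomp_closed ginv_closed)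
  let ?v = "\<alpha> g (u ?i \<otimes> u h)" and ?y = "u g \<otimes> u ?k" and ?w = "\<alpha> ?i (u g \<otimes> u ?k)"
  have iD: "u ?i \<otimes> u h \<in> D ?i" "u ?i \<otimes> u h \<in> D h"
    using c i by (auto intro: D_mult_left D_mult_right u_in_D u_closed)
  have v: "?v \<in> D g" "?v \<in> D ?k"
    using iD c by (auto intro: \<alpha>_closed \<alpha>_Int[OF gh])
  have y: "?y \<in> D g" "?y \<in> D ?k"
    using c k by (auto intro: D_mult_left D_mult_right u_in_D u_closed)
  have w: "?w \<in> D ?i" "?w \<in> D h"
    using \<alpha>_closed[OF i, of ?y] \<alpha>_Int[OF composable_ginv_left[of g ?k], of ?y] y c k
    by (simp_all add: ginv_ginv gran_gcomp[OF gh] gcomp_ginv_cancel_left[OF gh])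
  have vR: "?v \<in> carrier R" using D_closed[OF c(1) v(1)] .
  have wR: "?w \<in> carrier R" using D_closed[OF i w(1)] .
  \<comment> \<open>\<open>?w\<close> lies in the first ideal, whose identity therefore fixes it; under \<open>\<alpha> g\<close> this becomes \<open>?y ?v = ?y\<close>.\<close>
  have "?w \<otimes> (u ?i \<otimes> u h) = ?w"
    using w i c wR by (simp add: m_assoc[symmetric] u_closed D_unit_right)
  then have "\<alpha> g ?w = \<alpha> g ?w \<otimes> ?v"
    using \<alpha>_mult[OF c(1) w(1) iD(1)] by simp
  then have "?y = ?y \<otimes> ?v"
    using \<alpha>_\<alpha>_inverse[OF c(1) y(1)] by simp
  also have "\<dots> = u g \<otimes> (u ?k \<otimes> ?v)"
    using vR c k by (simp add: m_assoc u_closed)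
  also have "\<dots> = ?v"
    using v c k by (simp add: D_unit_left)
  finally show ?thesis by simp
qed

section \<open>The globally defined maps beta\<close>

text \<open>The total extension of the partial isomorphism \<open>\<alpha> g\<close>, zero on the complementary summand of its domain.
It is an endomorphism of \<open>R\<close> as a ring without identity.\<close>

definition \<beta> :: "'g \<Rightarrow> 'a \<Rightarrow> 'a" where
  "\<beta> g x = \<alpha> g (x \<otimes> u (ginv G g))"

lemma cut_in_D: "\<lbrakk>g \<in> carrier G; x \<in> carrier R\<rbrakk> \<Longrightarrow> x \<otimes> u g \<in> D g"
  by (simp add: D_mult_left u_in_D)

lemma \<beta>_in_D: "\<lbrakk>g \<in> carrier G; x \<in> carrier R\<rbrakk> \<Longrightarrow> \<beta> g x \<in> D g"
  by (simp add: \<beta>_def \<alpha>_closed cut_in_D ginv_closed)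

lemma \<beta>_closed: "\<lbrakk>g \<in> carrier G; x \<in> carrier R\<rbrakk> \<Longrightarrow> \<beta> g x \<in> carrier R"
  using \<beta>_in_D D_closed by blast

lemma \<beta>_u: "\<lbrakk>g \<in> carrier G; x \<in> carrier R\<rbrakk> \<Longrightarrow> \<beta> g x \<otimes> u g = \<beta> g x"
  by (simp add: \<beta>_in_D D_unit_right)

lemma \<beta>_eq_\<alpha>: "\<lbrakk>g \<in> carrier G; x \<in> D (ginv G g)\<rbrakk> \<Longrightarrow> \<beta> g x = \<alpha> g x"
  by (simp add: \<beta>_def D_unit_right ginv_closed)

lemma \<beta>_cut: "\<lbrakk>g \<in> carrier G; x \<in> carrier R\<rbrakk> \<Longrightarrow> \<beta> g (x \<otimes> u (ginv G g)) = \<beta> g x"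
  by (simp add: \<beta>_def m_assoc u_closed ginv_closed u_idem)

lemma \<beta>_add: "\<lbrakk>g \<in> carrier G; x \<in> carrier R; y \<in> carrier R\<rbrakk> \<Longrightarrow> \<beta> g (x \<oplus> y) = \<beta> g x \<oplus> \<beta> g y"
  by (simp add: \<beta>_def l_distr u_closed ginv_closed \<alpha>_add cut_in_D)

lemma \<beta>_mult:
  assumes "g \<in> carrier G" "x \<in> carrier R" "y \<in> carrier R"
  shows "\<beta> g (x \<otimes> y) = \<beta> g x \<otimes> \<beta> g y"
proof -
  let ?i = "ginv G g"
  have i: "?i \<in> carrier G" using assms(1) by (rule ginv_closed)
  have "(x \<otimes> u ?i) \<otimes> (y \<otimes> u ?i) = x \<otimes> ((u ?i \<otimes> y) \<otimes> u ?i)"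
    using assms i by (simp add: m_assoc m_closed u_closed)
  also have "\<dots> = (x \<otimes> y) \<otimes> u ?i"
    using assms i by (simp add: u_central) (simp add: m_assoc m_closed u_closed u_idem)
  finally show ?thesis
    using \<alpha>_mult[OF assms(1), of "x \<otimes> u ?i" "y \<otimes> u ?i"] assms i by (simp add: \<beta>_def cut_in_D)
qed

lemma \<beta>_hom: "g \<in> carrier G \<Longrightarrow> abelian_group_hom R R (\<beta> g)"
  by (intro abelian_group_homI_additive abelian_group_axioms) (auto simp: \<beta>_closed \<beta>_add)

lemma \<beta>_zero: "g \<in> carrier G \<Longrightarrow> \<beta> g \<zero> = \<zero>"
  by (rule abelian_group_hom.hom_zero[OF \<beta>_hom])

text \<open>Cutting \<open>x\<close> down to \<open>?z = x 1\<^bsub>h\<^sup>-\<^sup>1\<^esub> 1\<^bsub>(gh)\<^sup>-\<^sup>1\<^esub>\<close> makes both steps of the composition defined; by \<open>\<alpha>_u_u\<close>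
this cut is the projection of \<open>\<beta> h x\<close> to \<open>D\<^bsub>g\<^sup>-\<^sup>1\<^esub>\<close> on one side and produces the factor \<open>1\<^sub>g\<close> on
the other.\<close>

lemma \<beta>_composable:
  assumes gh: "(g, h) \<in> composable G" and x: "x \<in> carrier R"
  shows "\<beta> g (\<beta> h x) = \<beta> (gcomp G g h) x \<otimes> u g"
proof -
  note c = composableD[OF gh]
  let ?k = "gcomp G g h" and ?i = "ginv G h"
  have k: "?k \<in> carrier G" and i: "?i \<in> carrier G" and gi: "ginv G g \<in> carrier G"
      and ki: "ginv G ?k \<in> carrier G"
    using gh c by (simp_all add: gcomp_closed ginv_closed)
  have hk: "(h, ginv G ?k) \<in> composable G" "gcomp G h (ginv G ?k) = ginv G g"
    using gh c k gcomp_ginv_cancel_left'[of h "ginv G g"]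
    by (auto simp: ginv_gcomp composable_def ginv_closed gran_ginv gdom_gcomp gdom_ginv gcomp_closed
        composable_inverses gran_gcomp[OF composable_inverses[OF gh]])
  have kh: "(?k, ?i) \<in> composable G" "gcomp G ?k ?i = g"
    using gh c k by (auto simp: gcomp_ginv_cancel_right composable_def ginv_closed gran_ginv gdom_gcomp)
  let ?z = "x \<otimes> u ?i \<otimes> u (ginv G ?k)"
  have xi: "x \<otimes> u ?i \<in> D ?i"
    using x i by (rule cut_in_D[rotated])
  have u1: "u ?i \<otimes> (u ?i \<otimes> u (ginv G ?k)) = u ?i \<otimes> u (ginv G ?k)"
    using i ki by (simp add: m_assoc[symmetric] u_closed u_idem)
  have u2: "u (ginv G ?k) \<otimes> (u (ginv G ?k) \<otimes> u ?i) = u ?i \<otimes> u (ginv G ?k)"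
    using i ki u_central[OF i, of "u (ginv G ?k)"] by (simp add: m_assoc[symmetric] u_closed u_idem)
  have "\<alpha> h ?z = \<alpha> h ((x \<otimes> u ?i) \<otimes> (u ?i \<otimes> u (ginv G ?k)))"
    using x i ki u1 by (simp add: m_assoc m_closed u_closed)
  also have "\<dots> = \<beta> h x \<otimes> (u h \<otimes> u (ginv G g))"
    using \<alpha>_mult[OF c(2) xi] \<alpha>_u_u[OF hk(1)] i ki
    by (simp add: \<beta>_def hk(2) D_mult_right u_in_D u_closed)
  also have "\<dots> = \<beta> h x \<otimes> u (ginv G g)"
    using c x gi by (simp add: m_assoc[symmetric] \<beta>_closed u_closed \<beta>_u)
  finally have z: "\<alpha> h ?z = \<beta> h x \<otimes> u (ginv G g)" .
  have zD: "?z \<in> D ?i"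
    using xi i ki by (simp add: D_mult_right u_closed)
  have zg: "\<alpha> h ?z \<in> D (ginv G g) \<inter> D h"
    using c x gi zD by (simp add: z cut_in_D \<beta>_closed) (simp add: D_mult_right \<beta>_in_D u_closed)
  have "\<beta> g (\<beta> h x) = \<alpha> g (\<alpha> h ?z)"
    by (simp add: \<beta>_def[of g] z)
  also have "\<dots> = \<alpha> ?k ?z"
    by (rule \<alpha>_comp[OF gh zD zg])
  also have "?z = (x \<otimes> u (ginv G ?k)) \<otimes> (u (ginv G ?k) \<otimes> u ?i)"
    using x i ki u2 by (simp add: m_assoc m_closed u_closed)
  also have "\<alpha> ?k \<dots> = \<beta> ?k x \<otimes> (u ?k \<otimes> u g)"
    using \<alpha>_mult[OF k, of "x \<otimes> u (ginv G ?k)" "u (ginv G ?k) \<otimes> u ?i"] \<alpha>_u_u[OF kh(1)] x i ki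
    by (simp add: \<beta>_def kh(2) D_mult_right u_in_D u_closed cut_in_D)
  also have "\<dots> = \<beta> ?k x \<otimes> u g"
    using c x k by (simp add: m_assoc[symmetric] \<beta>_closed u_closed \<beta>_u)
  finally show ?thesis .
qed

text \<open>\<open>\<beta> h x\<close> lies in the summand of the range of \<open>h\<close>, while \<open>\<beta> g\<close> first projects to the summand
of the source of \<open>g\<close>.\<close>

lemma \<beta>_not_composable:
  assumes "g \<in> carrier G" "h \<in> carrier G" "(g, h) \<notin> composable G" "x \<in> carrier R"
  shows "\<beta> g (\<beta> h x) = \<zero>"
proof -
  have "\<beta> h x \<otimes> u (ginv G g) = \<zero>"
    using assms by (intro D_orthogonal[of h "ginv G g"])
      (auto simp: composable_def gran_ginv ginv_closed \<beta>_in_D u_in_D)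
  then show ?thesis
    using \<beta>_cut[of g "\<beta> h x"] assms by (simp add: \<beta>_closed \<beta>_zero)
qed

lemma \<beta>_unity: "g \<in> carrier G \<Longrightarrow> \<beta> g unity_R = u g"
proof -
  assume g: "g \<in> carrier G"
  have "\<alpha> g (u (ginv G g)) = u g"
    using \<alpha>_u_u[of g "ginv G g"] composable_ginv(1)[OF g] g u_gran[OF g] u_idem[of "ginv G g"]
    by (simp add: ginv_closed gran_def)
  then show ?thesis
    using g by (simp add: \<beta>_def unity_left u_closed ginv_closed)
qed

text \<open>This is the composition rule at \<open>x = 1\<close>, because \<open>\<beta> h 1 = 1\<^sub>h\<close>.\<close>

lemma \<beta>_of_u: "(g, h) \<in> composable G \<Longrightarrow> \<beta> g (u h) = u (gcomp G g h) \<otimes> u g"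
  using \<beta>_composable[of g h unity_R] composableD[of g h] gcomp_closed[of g h]
  by (simp add: \<beta>_unity unity_closed)

lemma \<beta>_identity: "\<lbrakk>e \<in> identities G; x \<in> carrier R\<rbrakk> \<Longrightarrow> \<beta> e x = x \<otimes> u e"
  by (simp add: \<beta>_def ginv_of_identity \<alpha>_identity cut_in_D identity_closed)

lemma \<beta>_inverse:
  assumes g: "g \<in> carrier G" and x: "x \<in> carrier R"
  shows "\<beta> g (\<beta> (ginv G g) x) = x \<otimes> u g"
proof -
  have "\<beta> g (\<beta> (ginv G g) x) = x \<otimes> u (gran G g) \<otimes> u g"
    using \<beta>_composable[OF composable_ginv(1)[OF g] x] x
    by (simp add: gran_def[symmetric] \<beta>_identity gran_identity g)
  also have "\<dots> = x \<otimes> (u g \<otimes> u (gran G g))"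
    using g x gran_identity[OF g] identity_closed
    by (simp add: m_assoc u_closed u_central[OF g, of "u (gran G g)"])
  finally show ?thesis
    using g by (simp add: u_gran)
qed

lemma \<beta>_kill:
  assumes "g \<in> carrier G" "h \<in> carrier G" "x \<in> D h" "gdom G g \<noteq> gran G h"
  shows "\<beta> g x = \<zero>"
proof -
  have "x \<otimes> u (ginv G g) = \<zero>"
    using assms by (intro D_orthogonal[of h "ginv G g"]) (auto simp: gran_ginv ginv_closed u_in_D)
  then show ?thesis
    using \<beta>_cut[of g x] assms by (simp add: \<beta>_zero D_closed)
qed

section \<open>The partial skew groupoid ring\<close>

abbreviation A :: "('g \<Rightarrow> 'a) ring" where "A \<equiv> skew_ring G R D \<alpha> u"

text \<open>The monomial \<open>x \<delta>\<^sub>g\<close>.\<close>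

definition delta :: "'g \<Rightarrow> 'a \<Rightarrow> 'g \<Rightarrow> 'a" where
  "delta g x = (\<lambda>k\<in>carrier G. if k = g then x else \<zero>)"

lemma skew_carrier: "carrier A = (\<Pi>\<^sub>E g\<in>carrier G. D g)"
  and skew_zero: "\<zero>\<^bsub>A\<^esub> = (\<lambda>g\<in>carrier G. \<zero>)"
  and skew_add: "a \<oplus>\<^bsub>A\<^esub> b = (\<lambda>g\<in>carrier G. a g \<oplus> b g)"
  and skew_one: "\<one>\<^bsub>A\<^esub> = (\<lambda>g\<in>carrier G. if g \<in> identities G then u g else \<zero>)"
  by (simp_all add: skew_ring_def)

lemma skew_eqI:
  "\<lbrakk>a \<in> carrier A; b \<in> carrier A; \<And>g. g \<in> carrier G \<Longrightarrow> a g = b g\<rbrakk> \<Longrightarrow> a = b"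
  unfolding skew_carrier by (rule PiE_ext)

lemma skew_coeff: "\<lbrakk>a \<in> carrier A; g \<in> carrier G\<rbrakk> \<Longrightarrow> a g \<in> D g"
  by (auto simp: skew_carrier)

lemma skew_coeff_closed: "\<lbrakk>a \<in> carrier A; g \<in> carrier G\<rbrakk> \<Longrightarrow> a g \<in> carrier R"
  using skew_coeff D_closed by blast

lemma skew_abelian_group: "abelian_group A"
proof (rule abelian_groupI)
  fix a assume a: "a \<in> carrier A"
  have "(\<lambda>g\<in>carrier G. \<ominus> a g) \<in> carrier A"
    using a by (auto simp: skew_carrier intro!: D_minus)
  moreover have "(\<lambda>g\<in>carrier G. \<ominus> a g) \<oplus>\<^bsub>A\<^esub> a = \<zero>\<^bsub>A\<^esub>"
    using skew_coeff_closed[OF a] by (auto simp: skew_add skew_zero l_neg)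
  ultimately show "\<exists>b\<in>carrier A. b \<oplus>\<^bsub>A\<^esub> a = \<zero>\<^bsub>A\<^esub>" by blast
next
  fix a assume a: "a \<in> carrier A"
  then show "\<zero>\<^bsub>A\<^esub> \<oplus>\<^bsub>A\<^esub> a = a"
    using skew_coeff_closed[OF a] by (intro skew_eqI) (auto simp: skew_add skew_zero skew_carrier)
qed (auto simp: skew_carrier skew_add skew_zero D_add D_zero PiE_def Pi_def D_closed a_ac intro!: restrict_ext)

interpretation A: abelian_group A by (rule skew_abelian_group)

lemma delta_closed: "\<lbrakk>g \<in> carrier G; x \<in> D g\<rbrakk> \<Longrightarrow> delta g x \<in> carrier A"
  by (auto simp: skew_carrier delta_def D_zero)

lemma delta_apply: "k \<in> carrier G \<Longrightarrow> delta g x k = (if k = g then x else \<zero>)"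
  by (simp add: delta_def)

text \<open>Identities that are additive in an element of the skew ring need only be checked on monomials.
There is no case for zero, since zero is a monomial: a groupoid is non-empty.\<close>

lemma skew_induct [consumes 1, case_names delta add]:
  assumes a: "a \<in> carrier A"
    and delta: "\<And>g x. \<lbrakk>g \<in> carrier G; x \<in> D g\<rbrakk> \<Longrightarrow> P (delta g x)"
    and add: "\<And>a b. \<lbrakk>a \<in> carrier A; b \<in> carrier A; P a; P b\<rbrakk> \<Longrightarrow> P (a \<oplus>\<^bsub>A\<^esub> b)"
  shows "P a"
proof -
  define part where "part F = (\<lambda>k\<in>carrier G. if k \<in> F then a k else \<zero>)" for F
  have part: "part F \<in> carrier A" for F
    using skew_coeff[OF a] by (auto simp: part_def skew_carrier D_zero)
  have "P (part F)" if "finite F" "F \<subseteq> carrier G" for F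
    using that
  proof (induction F rule: finite_induct)
    case empty
    obtain g where g: "g \<in> carrier G" using nonempty by blast
    have "part {} = delta g \<zero>"
      by (auto simp: part_def delta_def)
    then show ?case
      using delta[OF g D_zero[OF g]] by simp
  next
    case (insert g F)
    have "part (insert g F) = delta g (a g) \<oplus>\<^bsub>A\<^esub> part F"
      using insert skew_coeff_closed[OF a] by (auto simp: part_def delta_def skew_add intro!: restrict_ext)
    then show ?case
      using insert by (auto intro!: add delta delta_closed part skew_coeff[OF a])
  qed
  then have "P (part (carrier G))"
    using finite_groupoid by blast
  moreover have "part (carrier G) = a"
    using part a by (intro skew_eqI) (auto simp: part_def)
  ultimately show ?thesis by simp
qed

definition factorizations :: "'g \<Rightarrow> ('g \<times> 'g) set" where
  "factorizations k = {(g, h). (g, h) \<in> composable G \<and> gcomp G g h = k}"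

lemma finite_factorizations: "finite (factorizations k)"
  by (rule finite_subset[of _ "carrier G \<times> carrier G"])
    (auto simp: factorizations_def finite_groupoid dest: composableD)

lemma factorizations_closed:
  "p \<in> factorizations k \<Longrightarrow> fst p \<in> carrier G" "p \<in> factorizations k \<Longrightarrow> snd p \<in> carrier G"
  by (auto simp: factorizations_def composable_def)

text \<open>Since \<open>a g\<close> is \<open>\<alpha> g\<close> of something, \<open>\<alpha> g (\<alpha> g\<^sup>-\<^sup>1 (a g) b) = a g \<cdot> \<beta> g b\<close>; this replaces the
product of the skew ring by one in which each factor occurs once and additively.\<close>

lemma skew_mult_apply:
  assumes a: "a \<in> carrier A" and b: "b \<in> carrier A" and k: "k \<in> carrier G"
  shows "(a \<otimes>\<^bsub>A\<^esub> b) k = (\<Oplus>p\<in>factorizations k. a (fst p) \<otimes> \<beta> (fst p) (b (snd p)))"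
proof -
  have *: "\<alpha> g (\<alpha> (ginv G g) (a g) \<otimes> b h) = a g \<otimes> \<beta> g (b h)" if gh: "g \<in> carrier G" "h \<in> carrier G" for g h
  proof -
    let ?y = "\<alpha> (ginv G g) (a g)"
    have y: "?y \<in> D (ginv G g)"
      using \<alpha>_closed[of "ginv G g" "a g"] skew_coeff[OF a gh(1)] gh by (simp add: ginv_closed ginv_ginv)
    note c = D_closed[OF ginv_closed[OF gh(1)] y] skew_coeff_closed[OF b gh(2)]
    have "\<alpha> g (?y \<otimes> b h) = \<beta> g (?y \<otimes> b h)"
      using y c gh by (simp add: \<beta>_eq_\<alpha> D_mult_right ginv_closed)
    also have "\<dots> = \<alpha> g ?y \<otimes> \<beta> g (b h)"
      using y c gh by (simp add: \<beta>_mult \<beta>_eq_\<alpha>)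
    finally show ?thesis
      using \<alpha>_\<alpha>_inverse[OF gh(1) skew_coeff[OF a gh(1)]] by simp
  qed
  have "(a \<otimes>\<^bsub>A\<^esub> b) k = (\<Oplus>p\<in>factorizations k. case p of (g, h) \<Rightarrow> \<alpha> g (\<alpha> (ginv G g) (a g) \<otimes> b h))"
    using k by (simp add: skew_ring_def factorizations_def)
  also have "\<dots> = (\<Oplus>p\<in>factorizations k. a (fst p) \<otimes> \<beta> (fst p) (b (snd p)))"
    using a b by (intro finsum_cong')
      (auto simp: case_prod_beta * factorizations_closed skew_coeff_closed \<beta>_closed m_closed)
  finally show ?thesis .
qed

lemma skew_term_closed:
  assumes "a \<in> carrier A" "b \<in> carrier A" "p \<in> factorizations k"
  shows "a (fst p) \<otimes> \<beta> (fst p) (b (snd p)) \<in> carrier R"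
  using assms factorizations_closed[of p k] by (simp add: skew_coeff_closed \<beta>_closed m_closed)

lemma skew_mult_closed:
  assumes a: "a \<in> carrier A" and b: "b \<in> carrier A"
  shows "a \<otimes>\<^bsub>A\<^esub> b \<in> carrier A"
proof -
  have "(a \<otimes>\<^bsub>A\<^esub> b) k \<in> D k" if k: "k \<in> carrier G" for k
  proof -
    have "(a g \<otimes> \<beta> g (b h)) \<otimes> u k = a g \<otimes> \<beta> g (b h)"
      if gh: "(g, h) \<in> composable G" "gcomp G g h = k" for g h
    proof -
      note c = composableD[OF gh(1)]
      have "\<beta> g (b h) \<otimes> u k = \<beta> g (b h)"
      proof -
        note ch = D_closed[OF c(2) skew_coeff[OF b c(2)]]
        have "\<beta> g (b h) = \<beta> g (b h \<otimes> u h)"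
          using D_unit_right[OF c(2) skew_coeff[OF b c(2)]] by simp
        also have "\<dots> = \<beta> g (b h) \<otimes> (u g \<otimes> u k)"
          using c ch k gh by (simp add: \<beta>_mult u_closed \<beta>_of_u u_central[OF c(1)])
        also have "\<dots> = \<beta> g (b h) \<otimes> u k"
          using c ch k by (simp add: m_assoc[symmetric] \<beta>_closed u_closed \<beta>_u)
        finally show ?thesis by simp
      qed
      then show ?thesis
        using c a b k by (simp add: m_assoc skew_coeff_closed \<beta>_closed u_closed)
    qed
    then have *: "(a (fst p) \<otimes> \<beta> (fst p) (b (snd p))) \<otimes> u k = a (fst p) \<otimes> \<beta> (fst p) (b (snd p))"
      if "p \<in> factorizations k" for p
      using that by (auto simp: factorizations_def)
    have "(a \<otimes>\<^bsub>A\<^esub> b) k \<otimes> u k = (\<Oplus>p\<in>factorizations k. (a (fst p) \<otimes> \<beta> (fst p) (b (snd p))) \<otimes> u k)"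
      using k a b by (simp only: skew_mult_apply)
        (intro abelian_group_hom.hom_finsum[OF mult_right_hom]; auto intro: skew_term_closed u_closed)
    also have "\<dots> = (a \<otimes>\<^bsub>A\<^esub> b) k"
      using a b k by (simp only: skew_mult_apply) (intro finsum_cong'; auto simp: * intro: skew_term_closed)
    finally show ?thesis
      using k a b by (auto simp: D_iff skew_mult_apply intro!: finsum_closed skew_term_closed)
  qed
  then show ?thesis
    by (auto simp: skew_carrier) (simp add: skew_ring_def)
qed

lemma skew_l_distr:
  assumes a: "a \<in> carrier A" and b: "b \<in> carrier A" and c: "c \<in> carrier A"
  shows "(a \<oplus>\<^bsub>A\<^esub> b) \<otimes>\<^bsub>A\<^esub> c = a \<otimes>\<^bsub>A\<^esub> c \<oplus>\<^bsub>A\<^esub> b \<otimes>\<^bsub>A\<^esub> c"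
proof (rule skew_eqI)
  fix k assume k: "k \<in> carrier G"
  have "((a \<oplus>\<^bsub>A\<^esub> b) \<otimes>\<^bsub>A\<^esub> c) k = (\<Oplus>p\<in>factorizations k.
      a (fst p) \<otimes> \<beta> (fst p) (c (snd p)) \<oplus> b (fst p) \<otimes> \<beta> (fst p) (c (snd p)))"
    using a b c k
    by (simp only: skew_mult_apply A.a_closed, intro finsum_cong')
      (auto simp: factorizations_closed skew_add l_distr skew_coeff_closed \<beta>_closed m_closed)
  also have "\<dots> = (a \<otimes>\<^bsub>A\<^esub> c) k \<oplus> (b \<otimes>\<^bsub>A\<^esub> c) k"
    using a b c k by (simp only: skew_mult_apply) (intro finsum_addf; auto intro: skew_term_closed)
  finally show "((a \<oplus>\<^bsub>A\<^esub> b) \<otimes>\<^bsub>A\<^esub> c) k = (a \<otimes>\<^bsub>A\<^esub> c \<oplus>\<^bsub>A\<^esub> b \<otimes>\<^bsub>A\<^esub> c) k"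
    using k by (simp add: skew_add)
qed (use assms in \<open>auto intro!: skew_mult_closed A.a_closed\<close>)

lemma skew_r_distr:
  assumes a: "a \<in> carrier A" and b: "b \<in> carrier A" and c: "c \<in> carrier A"
  shows "c \<otimes>\<^bsub>A\<^esub> (a \<oplus>\<^bsub>A\<^esub> b) = c \<otimes>\<^bsub>A\<^esub> a \<oplus>\<^bsub>A\<^esub> c \<otimes>\<^bsub>A\<^esub> b"
proof (rule skew_eqI)
  fix k assume k: "k \<in> carrier G"
  have "(c \<otimes>\<^bsub>A\<^esub> (a \<oplus>\<^bsub>A\<^esub> b)) k = (\<Oplus>p\<in>factorizations k.
      c (fst p) \<otimes> \<beta> (fst p) (a (snd p)) \<oplus> c (fst p) \<otimes> \<beta> (fst p) (b (snd p)))"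
    using a b c k
    by (simp only: skew_mult_apply A.a_closed, intro finsum_cong')
      (auto simp: factorizations_closed skew_add r_distr \<beta>_add skew_coeff_closed \<beta>_closed m_closed)
  also have "\<dots> = (c \<otimes>\<^bsub>A\<^esub> a) k \<oplus> (c \<otimes>\<^bsub>A\<^esub> b) k"
    using a b c k by (simp only: skew_mult_apply) (intro finsum_addf; auto intro: skew_term_closed)
  finally show "(c \<otimes>\<^bsub>A\<^esub> (a \<oplus>\<^bsub>A\<^esub> b)) k = (c \<otimes>\<^bsub>A\<^esub> a \<oplus>\<^bsub>A\<^esub> c \<otimes>\<^bsub>A\<^esub> b) k"
    using k by (simp add: skew_add)
qed (use assms in \<open>auto intro!: skew_mult_closed A.a_closed\<close>)

lemma skew_mult_zero_right: "a \<in> carrier A \<Longrightarrow> a \<otimes>\<^bsub>A\<^esub> \<zero>\<^bsub>A\<^esub> = \<zero>\<^bsub>A\<^esub>"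
  by (rule abelian_group_hom.hom_zero[OF abelian_group_homI_additive[OF skew_abelian_group skew_abelian_group]])
    (auto simp: skew_mult_closed skew_r_distr)

lemma skew_mult_zero_left: "a \<in> carrier A \<Longrightarrow> \<zero>\<^bsub>A\<^esub> \<otimes>\<^bsub>A\<^esub> a = \<zero>\<^bsub>A\<^esub>"
  by (rule abelian_group_hom.hom_zero[OF abelian_group_homI_additive[OF skew_abelian_group skew_abelian_group,
      where h = "\<lambda>x. x \<otimes>\<^bsub>A\<^esub> a"]])
    (auto simp: skew_mult_closed skew_l_distr)

lemma skew_sum_single:
  assumes a: "a \<in> carrier A" and b: "b \<in> carrier A" and k: "k \<in> carrier G"
    and gh: "(g, h) \<in> composable G" "gcomp G g h = k"
    and other: "\<And>g' h'. \<lbrakk>(g', h') \<in> composable G; gcomp G g' h' = k; (g', h') \<noteq> (g, h)\<rbrakk>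
      \<Longrightarrow> a g' = \<zero> \<or> b h' = \<zero>"
  shows "(a \<otimes>\<^bsub>A\<^esub> b) k = a g \<otimes> \<beta> g (b h)"
proof -
  have "(\<Oplus>p\<in>factorizations k. a (fst p) \<otimes> \<beta> (fst p) (b (snd p))) = a (fst (g, h)) \<otimes> \<beta> (fst (g, h)) (b (snd (g, h)))"
  proof (rule finsum_single)
    fix p assume p: "p \<in> factorizations k" "p \<noteq> (g, h)"
    obtain g' h' where p': "p = (g', h')" by (cases p)
    with p have c: "(g', h') \<in> composable G" and z: "a g' = \<zero> \<or> b h' = \<zero>"
      using other by (auto simp: factorizations_def)
    from z show "a (fst p) \<otimes> \<beta> (fst p) (b (snd p)) = \<zero>"
      using composableD[OF c] a b
      by (auto simp: p' l_null r_null \<beta>_zero \<beta>_closed skew_coeff_closed)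
  qed (use gh a b composableD[OF gh(1)] in
      \<open>simp_all add: finite_factorizations m_closed \<beta>_closed skew_coeff_closed\<close>, simp add: factorizations_def)
  then show ?thesis
    using skew_mult_apply[OF a b k] by simp
qed

lemma skew_sum_zero:
  assumes a: "a \<in> carrier A" and b: "b \<in> carrier A" and k: "k \<in> carrier G"
    and all: "\<And>g' h'. \<lbrakk>(g', h') \<in> composable G; gcomp G g' h' = k\<rbrakk> \<Longrightarrow> a g' = \<zero> \<or> b h' = \<zero>"
  shows "(a \<otimes>\<^bsub>A\<^esub> b) k = \<zero>"
proof -
  have "a (fst p) \<otimes> \<beta> (fst p) (b (snd p)) = \<zero>" if p: "p \<in> factorizations k" for p
  proof -
    obtain g' h' where p': "p = (g', h')" by (cases p)
    with p have c: "(g', h') \<in> composable G" and z: "a g' = \<zero> \<or> b h' = \<zero>"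
      using all by (auto simp: factorizations_def)
    from z show ?thesis
      using composableD[OF c] a b
      by (auto simp: p' l_null r_null \<beta>_zero \<beta>_closed skew_coeff_closed)
  qed
  then show ?thesis
    using skew_mult_apply[OF a b k] by (simp add: add.finprod_one_eqI)
qed

text \<open>A factorization \<open>k = g h\<close> with \<open>g\<close> given exists iff \<open>g\<close> and \<open>k\<close> have the same range, and
then \<open>h = g\<^sup>-\<^sup>1 k\<close>.\<close>

lemma delta_mult_apply:
  assumes g: "g \<in> carrier G" and x: "x \<in> D g" and b: "b \<in> carrier A" and k: "k \<in> carrier G"
  shows "(delta g x \<otimes>\<^bsub>A\<^esub> b) k =
    (if gran G g = gran G k then x \<otimes> \<beta> g (b (gcomp G (ginv G g) k)) else \<zero>)"
proof (cases "gran G g = gran G k")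
  case True
  have "(delta g x \<otimes>\<^bsub>A\<^esub> b) k = delta g x g \<otimes> \<beta> g (b (gcomp G (ginv G g) k))"
  proof (rule skew_sum_single[OF delta_closed[OF g x] b k])
    note c = composable_ginv_left[OF g k True]
    show "(g, gcomp G (ginv G g) k) \<in> composable G"
      using c g by (intro composableI) (auto simp: gcomp_closed gran_gcomp gran_ginv)
    show "gcomp G g (gcomp G (ginv G g) k) = k"
      using gcomp_ginv_cancel_left'[OF g k True] .
    fix g' h' assume gh: "(g', h') \<in> composable G" "gcomp G g' h' = k" "(g', h') \<noteq> (g, gcomp G (ginv G g) k)"
    then have "g' \<noteq> g"
      using gcomp_ginv_cancel_left[of g h'] by auto
    then show "delta g x g' = \<zero> \<or> b h' = \<zero>"
      using composableD[OF gh(1)] by (simp add: delta_apply)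
  qed
  then show ?thesis
    using True g by (simp add: delta_apply)
next
  case False
  have "(delta g x \<otimes>\<^bsub>A\<^esub> b) k = \<zero>"
  proof (rule skew_sum_zero[OF delta_closed[OF g x] b k])
    fix g' h' assume gh: "(g', h') \<in> composable G" "gcomp G g' h' = k"
    then have "g' \<noteq> g"
      using False gran_gcomp[OF gh(1)] by auto
    then show "delta g x g' = \<zero> \<or> b h' = \<zero>"
      using composableD[OF gh(1)] by (simp add: delta_apply)
  qed
  then show ?thesis using False by simp
qed

lemma mult_delta_apply:
  assumes h: "h \<in> carrier G" and y: "y \<in> D h" and a: "a \<in> carrier A" and k: "k \<in> carrier G"
  shows "(a \<otimes>\<^bsub>A\<^esub> delta h y) k =
    (if gdom G h = gdom G k then a (gcomp G k (ginv G h)) \<otimes> \<beta> (gcomp G k (ginv G h)) y else \<zero>)"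
proof (cases "gdom G h = gdom G k")
  case True
  have "(a \<otimes>\<^bsub>A\<^esub> delta h y) k = a (gcomp G k (ginv G h)) \<otimes> \<beta> (gcomp G k (ginv G h)) (delta h y h)"
  proof (rule skew_sum_single[OF a delta_closed[OF h y] k])
    note c = composable_ginv_right[OF h k True]
    show "(gcomp G k (ginv G h), h) \<in> composable G"
      using c h by (intro composableI) (auto simp: gcomp_closed gdom_gcomp gdom_ginv)
    show "gcomp G (gcomp G k (ginv G h)) h = k"
      using gcomp_ginv_cancel_right'[OF h k True] .
    fix g' h' assume gh: "(g', h') \<in> composable G" "gcomp G g' h' = k" "(g', h') \<noteq> (gcomp G k (ginv G h), h)"
    then have "h' \<noteq> h"
      using gcomp_ginv_cancel_right[of g' h] by auto
    then show "a g' = \<zero> \<or> delta h y h' = \<zero>"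
      using composableD[OF gh(1)] by (simp add: delta_apply)
  qed
  then show ?thesis
    using True h by (simp add: delta_apply)
next
  case False
  have "(a \<otimes>\<^bsub>A\<^esub> delta h y) k = \<zero>"
  proof (rule skew_sum_zero[OF a delta_closed[OF h y] k])
    fix g' h' assume gh: "(g', h') \<in> composable G" "gcomp G g' h' = k"
    then have "h' \<noteq> h"
      using False gdom_gcomp[OF gh(1)] by auto
    then show "a g' = \<zero> \<or> delta h y h' = \<zero>"
      using composableD[OF gh(1)] by (simp add: delta_apply)
  qed
  then show ?thesis using False by simp
qed

text \<open>The range of \<open>\<beta> g\<close> on \<open>D h\<close> is contained in \<open>D\<^sub>g \<inter> D\<^bsub>gh\<^esub>\<close>, because \<open>\<beta> g 1\<^sub>h = 1\<^bsub>gh\<^esub> 1\<^sub>g\<close>. In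
particular the product of two monomials is again a monomial.\<close>

lemma \<beta>_D_in:
  assumes gh: "(g, h) \<in> composable G" and y: "y \<in> D h"
  shows "\<beta> g y \<in> D (gcomp G g h)"
proof -
  note c = composableD[OF gh] and k = gcomp_closed[OF gh]
  note yR = D_closed[OF c(2) y]
  have "\<beta> g y = \<beta> g (y \<otimes> u h)"
    using D_unit_right[OF c(2) y] by simp
  also have "\<dots> = \<beta> g y \<otimes> (u (gcomp G g h) \<otimes> u g)"
    using c yR by (simp add: \<beta>_mult u_closed \<beta>_of_u[OF gh])
  also have "\<dots> \<in> D (gcomp G g h)"
    using c k yR by (intro D_mult_left D_mult_right u_in_D u_closed \<beta>_closed)
  finally show ?thesis .
qed

lemma delta_mult_delta:
  assumes g: "g \<in> carrier G" and x: "x \<in> D g" and h: "h \<in> carrier G" and y: "y \<in> D h"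
  shows "delta g x \<otimes>\<^bsub>A\<^esub> delta h y =
    (if (g, h) \<in> composable G then delta (gcomp G g h) (x \<otimes> \<beta> g y) else \<zero>\<^bsub>A\<^esub>)"
proof (rule skew_eqI)
  note xR = D_closed[OF g x] and yR = D_closed[OF h y]
  show "delta g x \<otimes>\<^bsub>A\<^esub> delta h y \<in> carrier A"
    using assms by (intro skew_mult_closed delta_closed)
  show "(if (g, h) \<in> composable G then delta (gcomp G g h) (x \<otimes> \<beta> g y) else \<zero>\<^bsub>A\<^esub>) \<in> carrier A"
    using xR y by (auto intro!: delta_closed D_mult_left \<beta>_D_in gcomp_closed)
  fix k assume k: "k \<in> carrier G"
  have eq: "gran G g = gran G k \<and> gcomp G (ginv G g) k = h \<longleftrightarrow> (g, h) \<in> composable G \<and> gcomp G g h = k"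
    using g h k gcomp_ginv_cancel_left'[of g k] gcomp_ginv_cancel_left[of g h]
      gran_gcomp[OF composable_ginv_left[of g k]] gran_gcomp[of g h]
    by (auto simp: composable_def gran_ginv)
  have "(delta g x \<otimes>\<^bsub>A\<^esub> delta h y) k =
      (if gran G g = gran G k \<and> gcomp G (ginv G g) k = h then x \<otimes> \<beta> g y else \<zero>)"
    using delta_mult_apply[OF g x delta_closed[OF h y] k] gcomp_closed[OF composable_ginv_left[OF g k]] g xR
    by (auto simp: delta_apply \<beta>_zero r_null)
  then show "(delta g x \<otimes>\<^bsub>A\<^esub> delta h y) k =
      (if (g, h) \<in> composable G then delta (gcomp G g h) (x \<otimes> \<beta> g y) else \<zero>\<^bsub>A\<^esub>) k"
    using k unfolding eq by (auto simp: delta_apply skew_zero)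
qed

text \<open>Both sides have the coefficient \<open>x \<beta> g y \<beta> (gh) z\<close>: the factor \<open>1\<^sub>g\<close> from the composition rule for
\<open>\<beta> g (\<beta> h z)\<close> is absorbed by \<open>\<beta> g y\<close>.\<close>

lemma skew_assoc_delta:
  assumes g: "g \<in> carrier G" "x \<in> D g" and h: "h \<in> carrier G" "y \<in> D h" and k: "k \<in> carrier G" "z \<in> D k"
  shows "(delta g x \<otimes>\<^bsub>A\<^esub> delta h y) \<otimes>\<^bsub>A\<^esub> delta k z = delta g x \<otimes>\<^bsub>A\<^esub> (delta h y \<otimes>\<^bsub>A\<^esub> delta k z)"
proof -
  note R = D_closed[OF g] D_closed[OF h] D_closed[OF k]
  note m = delta_closed[OF g] delta_closed[OF h] delta_closed[OF k]
  consider (both) "(g, h) \<in> composable G" "(h, k) \<in> composable G"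
    | (l) "(g, h) \<in> composable G" "(h, k) \<notin> composable G"
    | (r) "(g, h) \<notin> composable G" "(h, k) \<in> composable G"
    | (none) "(g, h) \<notin> composable G" "(h, k) \<notin> composable G"
    by blast
  then show ?thesis
  proof cases
    case both
    then have c: "(gcomp G g h, k) \<in> composable G" "(g, gcomp G h k) \<in> composable G"
      by (simp_all add: composable_def gdom_gcomp gran_gcomp gcomp_closed)
    have d: "x \<otimes> \<beta> g y \<in> D (gcomp G g h)" "y \<otimes> \<beta> h z \<in> D (gcomp G h k)"
      using both R g h k by (auto intro!: D_mult_left \<beta>_D_in gcomp_closed)
    note cl = gcomp_closed[OF both(1)]
    have "\<beta> g (y \<otimes> \<beta> h z) = \<beta> g y \<otimes> (\<beta> (gcomp G g h) z \<otimes> u g)"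
      using both R g h by (simp add: \<beta>_mult \<beta>_closed \<beta>_composable)
    also have "\<dots> = (\<beta> g y \<otimes> u g) \<otimes> \<beta> (gcomp G g h) z"
      using R g cl by (simp add: m_assoc \<beta>_closed u_closed u_central)
    also have "\<dots> = \<beta> g y \<otimes> \<beta> (gcomp G g h) z"
      using R g by (simp add: \<beta>_u)
    finally have "x \<otimes> \<beta> g (y \<otimes> \<beta> h z) = (x \<otimes> \<beta> g y) \<otimes> \<beta> (gcomp G g h) z"
      using R g cl by (simp add: m_assoc \<beta>_closed)
    then show ?thesis
      using both c d g h k by (simp add: delta_mult_delta gcomp_closed gcomp_assoc)
  next
    case l
    then have "(gcomp G g h, k) \<notin> composable G"
      by (auto simp: composable_def gdom_gcomp)
    then show ?thesis
      using l R g h k m by (simp add: delta_mult_delta gcomp_closed D_mult_left \<beta>_D_in \<beta>_closed skew_mult_zero_right)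
  next
    case r
    then have "(g, gcomp G h k) \<notin> composable G"
      by (auto simp: composable_def gran_gcomp)
    then show ?thesis
      using r R g h k m by (simp add: delta_mult_delta gcomp_closed D_mult_left \<beta>_D_in \<beta>_closed skew_mult_zero_left)
  next
    case none
    then show ?thesis
      using g h k m by (simp add: delta_mult_delta skew_mult_zero_left skew_mult_zero_right)
  qed
qed

lemma skew_assoc:
  assumes a: "a \<in> carrier A" and b: "b \<in> carrier A" and c: "c \<in> carrier A"
  shows "(a \<otimes>\<^bsub>A\<^esub> b) \<otimes>\<^bsub>A\<^esub> c = a \<otimes>\<^bsub>A\<^esub> (b \<otimes>\<^bsub>A\<^esub> c)"
  using a
proof (induction rule: skew_induct)
  case (delta g x)
  note g = delta
  show ?case using b
  proof (induction rule: skew_induct)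
    case (delta h y)
    note h = delta
    show ?case using c
    proof (induction rule: skew_induct)
      case (delta k z)
      show ?case by (rule skew_assoc_delta[OF g h delta])
    qed (simp add: skew_r_distr skew_mult_closed delta_closed g h)
  qed (simp add: skew_r_distr skew_l_distr skew_mult_closed delta_closed g c)
qed (simp add: skew_l_distr skew_mult_closed b c)

lemma skew_one_closed: "\<one>\<^bsub>A\<^esub> \<in> carrier A"
  by (auto simp: skew_one skew_carrier u_in_D D_zero)

lemma skew_one_left:
  assumes "a \<in> carrier A" shows "\<one>\<^bsub>A\<^esub> \<otimes>\<^bsub>A\<^esub> a = a"
  using assms
proof (induction rule: skew_induct)
  case (delta h y)
  note yR = D_closed[OF delta]
  show ?case
  proof (rule skew_eqI)
    fix k assume k: "k \<in> carrier G"
    show "(\<one>\<^bsub>A\<^esub> \<otimes>\<^bsub>A\<^esub> delta h y) k = delta h y k"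
    proof (cases "k = h")
      case True
      have y: "u (gran G h) \<otimes> y = y" "y \<otimes> u (gran G h) = y"
        using D_unit_left[of "gran G h" y] D_unit_right[of "gran G h" y] delta D_subset_gran[of h]
          gran_identity identity_closed by auto
      have "(\<one>\<^bsub>A\<^esub> \<otimes>\<^bsub>A\<^esub> delta h y) h = u (gran G h) \<otimes> (y \<otimes> u (gran G h))"
        using mult_delta_apply[OF delta skew_one_closed delta(1)] delta yR
        by (simp add: gran_def[symmetric] skew_one gran_identity identity_closed \<beta>_identity)
      then show ?thesis
        using True delta y by (simp add: delta_apply)
    next
      case False
      have "gcomp G k (ginv G h) \<notin> identities G" if d: "gdom G h = gdom G k"
      proof
        assume i: "gcomp G k (ginv G h) \<in> identities G"
        have "gcomp G k (ginv G h) = gran G h"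
          using gdom_of_identity[OF i] gdom_gcomp[OF composable_ginv_right[OF delta(1) k d]] delta
          by (simp add: gdom_ginv)
        then have "k = h"
          using gcomp_ginv_cancel_right'[OF delta(1) k d] gran_gcomp_self[OF delta(1)] by simp
        then show False using False by simp
      qed
      then show ?thesis
        using mult_delta_apply[OF delta skew_one_closed k] False k yR
          gcomp_closed[OF composable_ginv_right[OF delta(1) k]]
        by (auto simp: skew_one delta_apply l_null \<beta>_closed)
    qed
  qed (use delta in \<open>auto intro!: skew_mult_closed skew_one_closed delta_closed\<close>)
qed (simp add: skew_r_distr skew_one_closed)

lemma skew_one_right:
  assumes "a \<in> carrier A" shows "a \<otimes>\<^bsub>A\<^esub> \<one>\<^bsub>A\<^esub> = a"
  using assms
proof (induction rule: skew_induct)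
  case (delta g x)
  note xR = D_closed[OF delta]
  show ?case
  proof (rule skew_eqI)
    fix k assume k: "k \<in> carrier G"
    show "(delta g x \<otimes>\<^bsub>A\<^esub> \<one>\<^bsub>A\<^esub>) k = delta g x k"
    proof (cases "k = g")
      case True
      have c: "(g, gdom G g) \<in> composable G"
        using delta by (simp add: composable_def gdom_identity identity_closed gran_of_identity)
      have "(delta g x \<otimes>\<^bsub>A\<^esub> \<one>\<^bsub>A\<^esub>) g = x \<otimes> \<beta> g (u (gdom G g))"
        using delta_mult_apply[OF delta skew_one_closed delta(1)] delta
        by (simp add: gdom_def[symmetric] skew_one gdom_identity identity_closed)
      also have "\<dots> = x"
        using delta by (simp add: \<beta>_of_u[OF c] gcomp_gdom u_idem D_unit_right)
      finally show ?thesis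
        using True delta by (simp add: delta_apply)
    next
      case False
      have "gcomp G (ginv G g) k \<notin> identities G" if d: "gran G g = gran G k"
      proof
        assume i: "gcomp G (ginv G g) k \<in> identities G"
        have "gcomp G (ginv G g) k = gdom G g"
          using gran_of_identity[OF i] gran_gcomp[OF composable_ginv_left[OF delta(1) k d]] delta
          by (simp add: gran_ginv)
        then have "k = g"
          using gcomp_ginv_cancel_left'[OF delta(1) k d] gcomp_gdom[OF delta(1)] by simp
        then show False using False by simp
      qed
      then show ?thesis
        using delta_mult_apply[OF delta skew_one_closed k] False k xR delta
          gcomp_closed[OF composable_ginv_left[OF delta(1) k]]
        by (auto simp: skew_one delta_apply r_null \<beta>_zero)
    qed
  qed (use delta in \<open>auto intro!: skew_mult_closed skew_one_closed delta_closed\<close>)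
qed (simp add: skew_l_distr skew_one_closed)

lemma skew_ring: "ring A"
  by (intro ringI skew_abelian_group monoidI)
    (simp_all add: skew_mult_closed skew_one_closed skew_assoc skew_one_left skew_one_right
      skew_l_distr skew_r_distr)

section \<open>Invariants and the two actions on R\<close>

abbreviation B :: "'a ring" where "B \<equiv> invariant_ring G R \<alpha> u"

lemma invariant_carrier:
  "x \<in> carrier B \<longleftrightarrow> x \<in> carrier R \<and> (\<forall>g\<in>carrier G. \<beta> g x = x \<otimes> u g)"
  by (simp add: invariant_ring_def \<beta>_def)

lemma invariant_simps:
  "monoid.mult B = monoid.mult R" "\<one>\<^bsub>B\<^esub> = unity_R" "\<zero>\<^bsub>B\<^esub> = \<zero>" "add B = add R"
  by (simp_all add: invariant_ring_def)

lemma invariant_closed: "x \<in> carrier B \<Longrightarrow> x \<in> carrier R"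
  and invariant: "\<lbrakk>x \<in> carrier B; g \<in> carrier G\<rbrakk> \<Longrightarrow> \<beta> g x = x \<otimes> u g"
  by (simp_all add: invariant_carrier)

text \<open>Invariants pass through \<open>\<beta> g\<close> because the factor in \<open>\<beta> g b = b 1\<^sub>g\<close> is absorbed by \<open>\<beta> g x\<close>.\<close>

lemma \<beta>_invariant_left:
  assumes "b \<in> carrier B" "g \<in> carrier G" "x \<in> carrier R"
  shows "\<beta> g (b \<otimes> x) = b \<otimes> \<beta> g x"
  using assms invariant_closed[OF assms(1)]
  by (simp add: \<beta>_mult invariant m_assoc u_closed \<beta>_closed u_central \<beta>_u)

lemma \<beta>_invariant_right:
  assumes "b \<in> carrier B" "g \<in> carrier G" "x \<in> carrier R"
  shows "\<beta> g (x \<otimes> b) = \<beta> g x \<otimes> b"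
  using assms invariant_closed[OF assms(1)]
  by (simp add: \<beta>_mult invariant u_central[symmetric])
    (simp add: m_assoc[symmetric] u_closed \<beta>_closed \<beta>_u)

lemma invariant_ring: "ring B"
proof (rule ringI)
  have m: "\<ominus> x \<in> carrier B" if "x \<in> carrier B" for x
    using that abelian_group_hom.hom_a_inv[OF \<beta>_hom, of _ x]
    by (auto simp: invariant_carrier l_minus u_closed)
  show "abelian_group B"
  proof (rule abelian_groupI)
    show "\<exists>y\<in>carrier B. y \<oplus>\<^bsub>B\<^esub> x = \<zero>\<^bsub>B\<^esub>" if "x \<in> carrier B" for x
      using m[OF that] that by (intro bexI[of _ "\<ominus> x"]) (auto simp: invariant_simps invariant_carrier l_neg)
  qed (auto simp: invariant_carrier invariant_simps \<beta>_add l_distr u_closed a_ac \<beta>_zero l_null)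
  show "monoid B"
  proof (rule monoidI)
    fix x y assume xy: "x \<in> carrier B" "y \<in> carrier B"
    then show "x \<otimes>\<^bsub>B\<^esub> y \<in> carrier B"
      using \<beta>_invariant_left[OF xy(1) _ invariant_closed[OF xy(2)]]
      by (simp add: invariant_simps invariant_carrier m_closed m_assoc u_closed)
  qed (auto simp: invariant_simps invariant_carrier unity_closed \<beta>_unity unity_left unity_right u_closed m_assoc)
qed (auto simp: invariant_simps invariant_carrier l_distr r_distr)

interpretation B: ring B by (rule invariant_ring)

abbreviation act_left :: "('g \<Rightarrow> 'a) \<Rightarrow> 'a \<Rightarrow> 'a" where "act_left \<equiv> skew_lact G R \<alpha> u"

abbreviation act_right :: "'a \<Rightarrow> ('g \<Rightarrow> 'a) \<Rightarrow> 'a" where "act_right \<equiv> skew_ract G R \<alpha>"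

lemma act_left_eq: "act_left a x = (\<Oplus>g\<in>carrier G. a g \<otimes> \<beta> g x)"
  by (simp add: skew_lact_def \<beta>_def)

lemma act_right_eq:
  assumes "a \<in> carrier A" "x \<in> carrier R"
  shows "act_right x a = (\<Oplus>g\<in>carrier G. \<beta> (ginv G g) (x \<otimes> a g))"
  unfolding skew_ract_def using assms
  by (intro finsum_cong')
    (auto simp: \<beta>_eq_\<alpha>[symmetric] ginv_closed ginv_ginv D_mult_left skew_coeff skew_coeff_closed m_closed \<beta>_closed)

lemma act_left_closed: "\<lbrakk>a \<in> carrier A; x \<in> carrier R\<rbrakk> \<Longrightarrow> act_left a x \<in> carrier R"
  by (auto simp: act_left_eq skew_coeff_closed \<beta>_closed m_closed intro!: finsum_closed)

lemma act_left_add: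
  "\<lbrakk>a \<in> carrier A; x \<in> carrier R; y \<in> carrier R\<rbrakk> \<Longrightarrow> act_left a (x \<oplus> y) = act_left a x \<oplus> act_left a y"
  unfolding act_left_eq
  by (rule finsum_eq_add) (auto simp: skew_coeff_closed \<beta>_closed m_closed \<beta>_add r_distr)

lemma add_act_left:
  "\<lbrakk>a \<in> carrier A; b \<in> carrier A; x \<in> carrier R\<rbrakk> \<Longrightarrow> act_left (a \<oplus>\<^bsub>A\<^esub> b) x = act_left a x \<oplus> act_left b x"
  unfolding act_left_eq
  by (rule finsum_eq_add) (auto simp: skew_coeff_closed \<beta>_closed m_closed skew_add l_distr)

lemma act_left_delta:
  assumes "g \<in> carrier G" "c \<in> D g" "x \<in> carrier R"
  shows "act_left (delta g c) x = c \<otimes> \<beta> g x"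
proof -
  have "act_left (delta g c) x = delta g c g \<otimes> \<beta> g x"
    unfolding act_left_eq using assms
    by (intro finsum_single finite_groupoid) (auto simp: delta_apply D_closed \<beta>_closed m_closed l_null)
  then show ?thesis
    using assms by (simp add: delta_apply)
qed

lemma act_right_closed: "\<lbrakk>a \<in> carrier A; x \<in> carrier R\<rbrakk> \<Longrightarrow> act_right x a \<in> carrier R"
  by (auto simp: act_right_eq skew_coeff_closed \<beta>_closed m_closed ginv_closed intro!: finsum_closed)

lemma act_right_add:
  assumes "a \<in> carrier A" "x \<in> carrier R" "y \<in> carrier R"
  shows "act_right (x \<oplus> y) a = act_right x a \<oplus> act_right y a"
  using assms
  by (simp add: act_right_eq, intro finsum_eq_add)
    (auto simp: skew_coeff_closed \<beta>_closed m_closed ginv_closed \<beta>_add l_distr)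

lemma add_act_right:
  assumes "a \<in> carrier A" "b \<in> carrier A" "x \<in> carrier R"
  shows "act_right x (a \<oplus>\<^bsub>A\<^esub> b) = act_right x a \<oplus> act_right x b"
  using assms
  by (simp add: act_right_eq, intro finsum_eq_add)
    (auto simp: skew_coeff_closed \<beta>_closed m_closed ginv_closed skew_add \<beta>_add r_distr)

lemma act_right_delta:
  assumes "g \<in> carrier G" "c \<in> D g" "x \<in> carrier R"
  shows "act_right x (delta g c) = \<beta> (ginv G g) (x \<otimes> c)"
proof -
  have "act_right x (delta g c) = \<beta> (ginv G g) (x \<otimes> delta g c g)"
    unfolding act_right_eq[OF delta_closed[OF assms(1,2)] assms(3)] using assms
    by (intro finsum_single finite_groupoid)
      (auto simp: delta_apply D_closed \<beta>_closed m_closed ginv_closed r_null \<beta>_zero)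
  then show ?thesis
    using assms by (simp add: delta_apply)
qed

lemma act_left_zero:
  "x \<in> carrier R \<Longrightarrow> act_left \<zero>\<^bsub>A\<^esub> x = \<zero>"
  by (rule abelian_group_hom.hom_zero[OF abelian_group_homI_additive[OF skew_abelian_group abelian_group_axioms,
      where h = "\<lambda>a. act_left a x"]]) (auto simp: act_left_closed add_act_left)

lemma act_right_zero:
  "x \<in> carrier R \<Longrightarrow> act_right x \<zero>\<^bsub>A\<^esub> = \<zero>"
  by (rule abelian_group_hom.hom_zero[OF abelian_group_homI_additive[OF skew_abelian_group abelian_group_axioms,
      where h = "\<lambda>a. act_right x a"]]) (auto simp: act_right_closed add_act_right)

text \<open>On monomials, \<open>c \<beta> g (d \<beta> h x) = c \<beta> g d \<beta> (gh) x\<close> as for associativity, or both sides vanish.\<close>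

lemma mult_act_left:
  assumes a: "a \<in> carrier A" and b: "b \<in> carrier A" and x: "x \<in> carrier R"
  shows "act_left (a \<otimes>\<^bsub>A\<^esub> b) x = act_left a (act_left b x)"
  using a
proof (induction rule: skew_induct)
  case (delta g c)
  note g = delta and cR = D_closed[OF delta]
  show ?case using b
  proof (induction rule: skew_induct)
    case (delta h d)
    note dR = D_closed[OF delta]
    have eq: "act_left (delta g c) (act_left (delta h d) x) = c \<otimes> (\<beta> g d \<otimes> \<beta> g (\<beta> h x))"
      using g delta dR x by (simp add: act_left_delta m_closed \<beta>_closed \<beta>_mult)
    show ?case
    proof (cases "(g, h) \<in> composable G")
      case True
      note gh = gcomp_closed[OF True]
      have "\<beta> g d \<otimes> \<beta> g (\<beta> h x) = (\<beta> g d \<otimes> u g) \<otimes> \<beta> (gcomp G g h) x"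
        using g dR x gh by (simp add: \<beta>_composable[OF True] m_assoc \<beta>_closed u_closed u_central)
      then have "c \<otimes> (\<beta> g d \<otimes> \<beta> g (\<beta> h x)) = (c \<otimes> \<beta> g d) \<otimes> \<beta> (gcomp G g h) x"
        using g dR cR x gh by (simp add: \<beta>_u m_assoc \<beta>_closed)
      then show ?thesis
        using True g delta cR x gh unfolding eq
        by (simp add: delta_mult_delta act_left_delta D_mult_left \<beta>_D_in)
    next
      case False
      then show ?thesis
        using g delta cR dR x
        by (simp add: eq delta_mult_delta act_left_zero \<beta>_not_composable r_null \<beta>_closed)
    qed
  next
    case (add b b')
    then show ?case
      using g x by (simp add: skew_r_distr add_act_left act_left_add act_left_closed delta_closed skew_mult_closed)
  qed
next
  case (add a a')
  then show ?case
    using b x by (simp add: skew_l_distr add_act_left act_left_closed skew_mult_closed)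
qed

lemma one_act_left:
  assumes x: "x \<in> carrier R" shows "act_left \<one>\<^bsub>A\<^esub> x = x"
proof -
  have "act_left \<one>\<^bsub>A\<^esub> x = (\<Oplus>g\<in>identities G. u g \<otimes> x)"
    unfolding act_left_eq
  proof (rule add.finprod_mono_neutral_cong_right)
    show "\<one>\<^bsub>A\<^esub> g \<otimes> \<beta> g x = \<zero>" if "g \<in> carrier G - identities G" for g
      using that x by (simp add: skew_one l_null \<beta>_closed)
    show "\<one>\<^bsub>A\<^esub> g \<otimes> \<beta> g x = u g \<otimes> x" if "g \<in> identities G" for g
      using that x identity_closed[OF that] by (simp add: skew_one \<beta>_identity u_central[symmetric])
        (simp add: m_assoc[symmetric] u_closed u_idem)
    show "(\<lambda>g. \<one>\<^bsub>A\<^esub> g \<otimes> \<beta> g x) \<in> carrier G \<rightarrow> carrier R"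
      using x by (auto intro!: m_closed \<beta>_closed skew_coeff_closed[OF skew_one_closed])
  qed (auto simp: finite_groupoid identity_closed)
  also have "\<dots> = unity_R \<otimes> x"
    unfolding unity_def using x
    by (intro abelian_group_hom.hom_finsum[OF mult_right_hom, symmetric]) (auto intro: u_closed identity_closed)
  finally show ?thesis
    using x by (simp add: unity_left)
qed

text \<open>On monomials, the inner factor \<open>d\<close> is first moved inside \<open>\<beta> g\<^sup>-\<^sup>1\<close>, where it becomes \<open>\<beta> g d\<close>; then the
composition rule for \<open>h\<^sup>-\<^sup>1 g\<^sup>-\<^sup>1 = (gh)\<^sup>-\<^sup>1\<close> applies. Its factor \<open>1\<^bsub>h\<^sup>-\<^sup>1\<^esub>\<close> changes nothing, as the argument
lies in \<open>D\<^sub>g\<close> and \<open>\<beta> (gh)\<^sup>-\<^sup>1\<close> maps \<open>D\<^sub>g\<close> into \<open>D\<^bsub>h\<^sup>-\<^sup>1\<^esub>\<close>.\<close>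

lemma mult_act_right:
  assumes a: "a \<in> carrier A" and b: "b \<in> carrier A" and x: "x \<in> carrier R"
  shows "act_right x (a \<otimes>\<^bsub>A\<^esub> b) = act_right (act_right x a) b"
  using a
proof (induction rule: skew_induct)
  case (delta g c)
  note g = delta and cR = D_closed[OF delta]
  note gi = ginv_closed[OF g(1)]
  show ?case using b
  proof (induction rule: skew_induct)
    case (delta h d)
    note dR = D_closed[OF delta] and hi = ginv_closed[OF delta(1)]
    have "\<beta> (ginv G g) (x \<otimes> c) \<otimes> d = \<beta> (ginv G g) (x \<otimes> c) \<otimes> (d \<otimes> u (ginv G g))"
      using g gi x cR dR u_central[OF gi dR, symmetric]
      by (simp add: m_assoc[symmetric] m_closed \<beta>_closed u_closed \<beta>_u)
    also have "d \<otimes> u (ginv G g) = \<beta> (ginv G g) (\<beta> g d)"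
      using \<beta>_inverse[OF gi dR] g by (simp add: ginv_ginv)
    finally have shift: "\<beta> (ginv G g) (x \<otimes> c) \<otimes> d = \<beta> (ginv G g) ((x \<otimes> c) \<otimes> \<beta> g d)"
      using g gi x cR dR by (simp add: \<beta>_mult m_closed \<beta>_closed)
    have eq: "act_right (act_right x (delta g c)) (delta h d)
        = \<beta> (ginv G h) (\<beta> (ginv G g) ((x \<otimes> c) \<otimes> \<beta> g d))"
      using g gi delta cR x by (simp add: act_right_delta m_closed \<beta>_closed shift)
    show ?case
    proof (cases "(g, h) \<in> composable G")
      case True
      let ?k = "gcomp G g h"
      note k = gcomp_closed[OF True] and inv = composable_inverses[OF True]
      note ki = ginv_closed[OF k]
      let ?z = "x \<otimes> (c \<otimes> \<beta> g d)"
      have z: "?z \<in> carrier R" "?z \<otimes> u g = ?z"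
        using g x cR dR by (simp_all add: m_closed \<beta>_closed m_assoc u_closed \<beta>_u)
      have comp: "(ginv G ?k, g) \<in> composable G" "gcomp G (ginv G ?k) g = ginv G h"
        using True g delta gcomp_ginv_cancel_right[OF inv]
        by (auto simp: ginv_gcomp ginv_ginv composable_def gdom_gcomp[OF inv] gdom_ginv inv
            gcomp_closed[OF inv])
      have "\<beta> (ginv G ?k) ?z = \<beta> (ginv G ?k) (?z \<otimes> u g)"
        by (simp add: z)
      also have "\<dots> = \<beta> (ginv G ?k) ?z \<otimes> (u (ginv G h) \<otimes> u (ginv G ?k))"
        using \<beta>_mult[OF ki z(1) u_closed[OF g(1)]] by (simp only: \<beta>_of_u[OF comp(1)] comp(2))
      also have "\<dots> = (\<beta> (ginv G ?k) ?z \<otimes> u (ginv G ?k)) \<otimes> u (ginv G h)"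
        using z ki hi by (simp add: m_assoc \<beta>_closed u_closed u_central[OF hi])
      also have "\<dots> = \<beta> (ginv G ?k) ?z \<otimes> u (ginv G h)"
        using z ki by (simp add: \<beta>_u)
      finally have "\<beta> (ginv G ?k) ?z = \<beta> (ginv G h) (\<beta> (ginv G g) ?z)"
        using z by (simp add: \<beta>_composable[OF inv] ginv_gcomp[OF True])
      then show ?thesis
        using True g delta cR dR x k unfolding eq
        by (simp add: delta_mult_delta act_right_delta D_mult_left \<beta>_D_in m_assoc \<beta>_closed)
    next
      case False
      then have "(ginv G h, ginv G g) \<notin> composable G"
        using composable_inverses[of "ginv G h" "ginv G g"] g delta by (auto simp: ginv_ginv)
      then show ?thesis
        using False g gi hi delta cR dR x
        by (simp add: eq delta_mult_delta act_right_zero \<beta>_not_composable m_closed \<beta>_closed)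
    qed
  next
    case (add b b')
    then show ?case
      using g x by (simp add: skew_r_distr add_act_right act_right_closed delta_closed skew_mult_closed)
  qed
next
  case (add a a')
  then show ?case
    using b x by (simp add: skew_l_distr add_act_right act_right_add act_right_closed skew_mult_closed)
qed

lemma one_act_right:
  assumes x: "x \<in> carrier R" shows "act_right x \<one>\<^bsub>A\<^esub> = x"
proof -
  have "act_right x \<one>\<^bsub>A\<^esub> = (\<Oplus>g\<in>identities G. x \<otimes> u g)"
    unfolding act_right_eq[OF skew_one_closed x]
  proof (rule add.finprod_mono_neutral_cong_right)
    show "\<beta> (ginv G g) (x \<otimes> \<one>\<^bsub>A\<^esub> g) = \<zero>" if "g \<in> carrier G - identities G" for g
      using that x by (simp add: skew_one r_null \<beta>_zero ginv_closed)
    show "\<beta> (ginv G g) (x \<otimes> \<one>\<^bsub>A\<^esub> g) = x \<otimes> u g" if "g \<in> identities G" for g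
      using that x identity_closed[OF that]
      by (simp add: skew_one ginv_of_identity \<beta>_identity m_closed u_closed m_assoc u_idem)
    show "(\<lambda>g. \<beta> (ginv G g) (x \<otimes> \<one>\<^bsub>A\<^esub> g)) \<in> carrier G \<rightarrow> carrier R"
      using x by (auto intro!: m_closed \<beta>_closed ginv_closed skew_coeff_closed[OF skew_one_closed])
  qed (auto simp: finite_groupoid identity_closed)
  also have "\<dots> = x \<otimes> unity_R"
    unfolding unity_def using x
    by (intro abelian_group_hom.hom_finsum[OF mult_left_hom, symmetric]) (auto intro: u_closed identity_closed)
  finally show ?thesis
    using x by (simp add: unity_right)
qed

lemma act_left_invariant:
  assumes a: "a \<in> carrier A" and x: "x \<in> carrier R" and b: "b \<in> carrier B"
  shows "act_left a (x \<otimes> b) = act_left a x \<otimes> b"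
  unfolding act_left_eq using a x b invariant_closed[OF b]
  by (subst abelian_group_hom.hom_finsum[OF mult_right_hom])
    (auto intro!: finsum_cong' simp: \<beta>_invariant_right m_assoc skew_coeff_closed \<beta>_closed m_closed)

lemma act_right_invariant:
  assumes a: "a \<in> carrier A" and x: "x \<in> carrier R" and b: "b \<in> carrier B"
  shows "act_right (b \<otimes> x) a = b \<otimes> act_right x a"
  using a x b invariant_closed[OF b]
  by (simp add: act_right_eq m_closed, subst abelian_group_hom.hom_finsum[OF mult_left_hom])
    (auto intro!: finsum_cong' simp: \<beta>_invariant_left m_assoc skew_coeff_closed \<beta>_closed m_closed ginv_closed)

abbreviation M :: "('g \<Rightarrow> 'a, 'a, 'a) bimod" where "M \<equiv> R_skew_inv G R \<alpha> u"

abbreviation M' :: "('a, 'g \<Rightarrow> 'a, 'a) bimod" where "M' \<equiv> R_inv_skew G R \<alpha>"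

lemma bimod_simps:
  "carrier M = carrier R" "add M = add R" "lact M = act_left" "ract M = monoid.mult R"
  "carrier M' = carrier R" "add M' = add R" "lact M' = monoid.mult R" "ract M' = act_right"
  by (simp_all add: R_skew_inv_def R_inv_skew_def as_bimod_def)

lemma as_bimod_abelian_group: "abelian_group (as_bimod R l r)"
  by (rule abelian_groupI) (auto simp: as_bimod_def a_ac intro!: bexI[of _ "\<ominus> x" for x] l_neg)

lemma R_bimodule_skew_inv: "bimodule A B M"
  by (intro bimodule.intro bimodule_axioms.intro skew_ring invariant_ring)
    (simp_all add: bimod_simps as_bimod_abelian_group[of "act_left" "monoid.mult R", folded R_skew_inv_def]
      invariant_simps invariant_closed act_left_closed act_left_add add_act_left mult_act_left one_act_left
      m_closed m_assoc l_distr r_distr unity_right act_left_invariant)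

lemma R_bimodule_inv_skew: "bimodule B A M'"
  by (intro bimodule.intro bimodule_axioms.intro skew_ring invariant_ring)
    (simp_all add: bimod_simps as_bimod_abelian_group[of "monoid.mult R" "act_right", folded R_inv_skew_def]
      invariant_simps invariant_closed act_right_closed act_right_add add_act_right mult_act_right one_act_right
      m_closed m_assoc l_distr r_distr unity_left act_right_invariant)

section \<open>The trace map\<close>

abbreviation tr :: "'a \<Rightarrow> 'a" where "tr \<equiv> trace_map G R \<alpha> u"

lemma trace_eq: "tr x = (\<Oplus>g\<in>carrier G. \<beta> g x)"
  by (simp add: trace_map_def \<beta>_def)

lemma trace_closed: "x \<in> carrier R \<Longrightarrow> tr x \<in> carrier R"
  by (auto simp: trace_eq \<beta>_closed intro!: finsum_closed)

lemma trace_add: "\<lbrakk>x \<in> carrier R; y \<in> carrier R\<rbrakk> \<Longrightarrow> tr (x \<oplus> y) = tr x \<oplus> tr y"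
  unfolding trace_eq
  by (rule finsum_eq_add) (auto simp: \<beta>_closed \<beta>_add)

text \<open>\<open>\<beta> k\<close> kills \<open>D h\<close> unless the source of \<open>k\<close> is the range of \<open>h\<close>. Restricted to the remaining \<open>k\<close>,
the sum can be reindexed by translation.\<close>

lemma trace_local:
  assumes h: "h \<in> carrier G" and x: "x \<in> D h"
  shows "tr x = (\<Oplus>k\<in>{k \<in> carrier G. gdom G k = gran G h}. \<beta> k x)"
  unfolding trace_eq
  by (rule add.finprod_mono_neutral_cong_right)
    (use assms in \<open>auto simp: finite_groupoid D_closed \<beta>_closed \<beta>_kill\<close>)

text \<open>Substitute \<open>k = g h\<^sup>-\<^sup>1\<close>. The factor \<open>1\<^sub>g\<close> of the composition rule \<open>\<beta> g (\<beta> h\<^sup>-\<^sup>1 x) = \<beta> k x 1\<^sub>g\<close> is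
absorbed, since \<open>x \<in> D\<^sub>h\<close> and \<open>\<beta> k\<close> maps \<open>D\<^sub>h\<close> into \<open>D\<^bsub>kh\<^esub> = D\<^sub>g\<close>.\<close>

lemma trace_\<beta>:
  assumes h: "h \<in> carrier G" and x: "x \<in> D h"
  shows "tr (\<beta> (ginv G h) x) = tr x"
proof -
  let ?i = "ginv G h"
  note i = ginv_closed[OF h] and xR = D_closed[OF h x]
  let ?S = "{g \<in> carrier G. gdom G g = gran G ?i}" and ?T = "{k \<in> carrier G. gdom G k = gran G h}"
  have S: "(g, ?i) \<in> composable G" if "g \<in> ?S" for g
    using that i by (simp add: composable_def)
  have shift: "\<beta> g (\<beta> ?i x) = \<beta> (gcomp G g ?i) x" if g: "g \<in> ?S" for g
  proof -
    let ?k = "gcomp G g ?i"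
    have gG: "g \<in> carrier G" and k: "?k \<in> carrier G"
      using g gcomp_closed[OF S[OF g]] by auto
    have kh: "(?k, h) \<in> composable G" "gcomp G ?k h = g"
      using h g gcomp_ginv_cancel_right[OF S[OF g]] k gdom_gcomp[OF S[OF g]]
      by (auto simp: ginv_ginv composable_def gdom_ginv)
    have "\<beta> ?k x = \<beta> ?k x \<otimes> (u g \<otimes> u ?k)"
      using \<beta>_mult[OF k xR u_closed[OF h]] D_unit_right[OF h x] \<beta>_of_u[OF kh(1)] kh(2) by simp
    also have "\<dots> = (\<beta> ?k x \<otimes> u ?k) \<otimes> u g"
      using gG k xR by (simp add: m_assoc \<beta>_closed u_closed u_central[OF gG])
    also have "\<dots> = \<beta> ?k x \<otimes> u g"
      using k xR by (simp add: \<beta>_u)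
    finally show ?thesis
      using \<beta>_composable[OF S[OF g] xR] by simp
  qed
  have inj: "inj_on (\<lambda>g. gcomp G g ?i) ?S"
    by (rule inj_on_inverseI[where g = "\<lambda>k. gcomp G k h"])
      (use gcomp_ginv_cancel_right[OF S] h in \<open>simp add: ginv_ginv\<close>)
  have img: "(\<lambda>g. gcomp G g ?i) ` ?S = ?T"
  proof (intro equalityI subsetI)
    fix k assume "k \<in> (\<lambda>g. gcomp G g ?i) ` ?S"
    then obtain g where g: "g \<in> ?S" "k = gcomp G g ?i" by blast
    then show "k \<in> ?T"
      using gcomp_closed[OF S[OF g(1)]] gdom_gcomp[OF S[OF g(1)]] h by (simp add: gdom_ginv)
  next
    fix k assume k: "k \<in> ?T"
    then have c: "(k, h) \<in> composable G"
      using h by (simp add: composable_def)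
    then have "gcomp G k h \<in> ?S" "k = gcomp G (gcomp G k h) ?i"
      using h by (simp_all add: gcomp_closed gdom_gcomp gran_ginv gcomp_ginv_cancel_right)
    then show "k \<in> (\<lambda>g. gcomp G g ?i) ` ?S" by blast
  qed
  have "tr (\<beta> ?i x) = (\<Oplus>g\<in>?S. \<beta> g (\<beta> ?i x))"
    by (rule trace_local[OF i \<beta>_in_D[OF i xR]])
  also have "\<dots> = (\<Oplus>g\<in>?S. \<beta> (gcomp G g ?i) x)"
    using xR by (intro finsum_cong') (auto simp: shift[simplified] intro!: \<beta>_closed gcomp_closed S)
  also have "\<dots> = (\<Oplus>k\<in>?T. \<beta> k x)"
    unfolding img[symmetric] using xR inj
    by (intro finsum_reindex[symmetric]) (auto intro!: \<beta>_closed gcomp_closed S)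
  also have "\<dots> = tr x"
    by (rule trace_local[OF h x, symmetric])
  finally show ?thesis .
qed

text \<open>\<open>\<beta> h\<close> turns the term \<open>\<beta> g x\<close> into \<open>\<beta> (hg) x 1\<^sub>h\<close> if \<open>hg\<close> is defined and kills it otherwise. The
products \<open>hg\<close> run through the elements with the range of \<open>h\<close>; the terms of \<open>tr x\<close> with
another range are killed by \<open>1\<^sub>h\<close>.\<close>

lemma trace_invariant:
  assumes x: "x \<in> carrier R" shows "tr x \<in> carrier B"
proof -
  have "\<beta> h (tr x) = tr x \<otimes> u h" if h: "h \<in> carrier G" for h
  proof -
    let ?S = "{g \<in> carrier G. gran G g = gdom G h}" and ?T = "{k \<in> carrier G. gran G k = gran G h}"
    have S: "(h, g) \<in> composable G" if "g \<in> ?S" for g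
      using that h by (simp add: composable_def)
    have inj: "inj_on (gcomp G h) ?S"
      by (rule inj_on_inverseI[where g = "gcomp G (ginv G h)"]) (use gcomp_ginv_cancel_left[OF S] in simp)
    have img: "gcomp G h ` ?S = ?T"
    proof (intro equalityI subsetI)
      fix k assume "k \<in> gcomp G h ` ?S"
      then obtain g where g: "g \<in> ?S" "k = gcomp G h g" by blast
      then show "k \<in> ?T"
        using gcomp_closed[OF S[OF g(1)]] gran_gcomp[OF S[OF g(1)]] by simp
    next
      fix k assume k: "k \<in> ?T"
      then have c: "(ginv G h, k) \<in> composable G"
        using h by (intro composable_ginv_left) auto
      then have "gcomp G (ginv G h) k \<in> ?S" "k = gcomp G h (gcomp G (ginv G h) k)"
        using h k by (simp_all add: gcomp_closed gran_gcomp gran_ginv gcomp_ginv_cancel_left')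
      then show "k \<in> gcomp G h ` ?S" by blast
    qed
    have "\<beta> h (tr x) = (\<Oplus>g\<in>carrier G. \<beta> h (\<beta> g x))"
      unfolding trace_eq using x h by (intro abelian_group_hom.hom_finsum[OF \<beta>_hom]) (auto simp: \<beta>_closed)
    also have "\<dots> = (\<Oplus>g\<in>?S. \<beta> (gcomp G h g) x \<otimes> u h)"
    proof (rule add.finprod_mono_neutral_cong_right)
      show "\<beta> h (\<beta> g x) = \<zero>" if "g \<in> carrier G - ?S" for g
        using that h x by (intro \<beta>_not_composable) (auto simp: composable_def)
      show "\<beta> h (\<beta> g x) = \<beta> (gcomp G h g) x \<otimes> u h" if "g \<in> ?S" for g
        using \<beta>_composable[OF S[OF that] x] .
    qed (use x h in \<open>auto simp: finite_groupoid \<beta>_closed\<close>)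
    also have "\<dots> = (\<Oplus>k\<in>?T. \<beta> k x \<otimes> u h)"
      unfolding img[symmetric] using x inj h
      by (intro finsum_reindex[symmetric]) (auto intro!: m_closed u_closed \<beta>_closed gcomp_closed S)
    also have "\<dots> = (\<Oplus>k\<in>carrier G. \<beta> k x \<otimes> u h)"
      by (rule add.finprod_mono_neutral_cong_left)
        (use x h in \<open>auto simp: finite_groupoid \<beta>_closed m_closed u_closed intro: D_orthogonal \<beta>_in_D u_in_D\<close>)
    also have "\<dots> = tr x \<otimes> u h"
      unfolding trace_eq using x h
      by (intro abelian_group_hom.hom_finsum[OF mult_right_hom, symmetric]) (auto simp: \<beta>_closed u_closed)
    finally show ?thesis .
  qed
  then show ?thesis
    using x by (simp add: invariant_carrier trace_closed)
qed

lemma trace_mult_left: "\<lbrakk>b \<in> carrier B; x \<in> carrier R\<rbrakk> \<Longrightarrow> tr (b \<otimes> x) = b \<otimes> tr x"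
  unfolding trace_eq using invariant_closed[of b]
  by (subst abelian_group_hom.hom_finsum[OF mult_left_hom])
    (auto intro!: finsum_cong' simp: \<beta>_invariant_left \<beta>_closed m_closed)

lemma trace_mult_right: "\<lbrakk>b \<in> carrier B; x \<in> carrier R\<rbrakk> \<Longrightarrow> tr (x \<otimes> b) = tr x \<otimes> b"
  unfolding trace_eq using invariant_closed[of b]
  by (subst abelian_group_hom.hom_finsum[OF mult_right_hom])
    (auto intro!: finsum_cong' simp: \<beta>_invariant_right \<beta>_closed m_closed)

lemma trace_mult_right_assoc:
  "\<lbrakk>b \<in> carrier B; x \<in> carrier R; y \<in> carrier R\<rbrakk> \<Longrightarrow> tr (x \<otimes> (y \<otimes> b)) = tr (x \<otimes> y) \<otimes> b"
  using trace_mult_right[of b "x \<otimes> y"] by (simp add: m_assoc m_closed invariant_closed)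

lemma trace_inverses:
  assumes x: "x \<in> carrier R" shows "(\<Oplus>g\<in>carrier G. \<beta> (ginv G g) x) = tr x"
proof -
  have inj: "inj_on (ginv G) (carrier G)"
    by (rule inj_on_inverseI[where g = "ginv G"]) (rule ginv_ginv)
  have "ginv G ` carrier G = carrier G"
    using ginv_ginv ginv_closed by force
  then show ?thesis
    using finsum_reindex[of "\<lambda>g. \<beta> g x" "ginv G" "carrier G"] x inj by (simp add: trace_eq \<beta>_closed ginv_closed)
qed

text \<open>On a monomial \<open>c \<delta>\<^sub>h\<close>, moving \<open>y\<close> inside \<open>\<beta> h\<^sup>-\<^sup>1\<close> gives
\<open>\<beta> h\<^sup>-\<^sup>1 (x c) y = \<beta> h\<^sup>-\<^sup>1 (x c \<beta> h y)\<close>, and the trace does not see the outer \<open>\<beta> h\<^sup>-\<^sup>1\<close>.\<close>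

lemma trace_balanced:
  assumes a: "a \<in> carrier A" and x: "x \<in> carrier R" and y: "y \<in> carrier R"
  shows "tr (act_right x a \<otimes> y) = tr (x \<otimes> act_left a y)"
  using a
proof (induction rule: skew_induct)
  case (delta h c)
  note cR = D_closed[OF delta] and i = ginv_closed[OF delta(1)]
  have "\<beta> (ginv G h) (x \<otimes> c) \<otimes> y = \<beta> (ginv G h) (x \<otimes> c) \<otimes> (y \<otimes> u (ginv G h))"
    using delta i x y cR u_central[OF i y, symmetric]
    by (simp add: m_assoc[symmetric] m_closed \<beta>_closed u_closed \<beta>_u)
  also have "y \<otimes> u (ginv G h) = \<beta> (ginv G h) (\<beta> h y)"
    using \<beta>_inverse[OF i y] delta by (simp add: ginv_ginv)
  finally have "\<beta> (ginv G h) (x \<otimes> c) \<otimes> y = \<beta> (ginv G h) (x \<otimes> (c \<otimes> \<beta> h y))"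
    using delta i x y cR by (simp add: \<beta>_mult m_closed \<beta>_closed m_assoc)
  moreover have "x \<otimes> (c \<otimes> \<beta> h y) \<in> D h"
    using delta x y cR by (intro D_mult_left D_mult_right) (auto simp: \<beta>_closed m_closed)
  ultimately show ?case
    using delta x y by (simp add: act_right_delta act_left_delta trace_\<beta>)
next
  case (add a b)
  then show ?case
    using x y by (simp add: add_act_right add_act_left l_distr r_distr act_right_closed act_left_closed
        trace_add m_closed)
qed

section \<open>The Morita context\<close>

text \<open>The element \<open>\<Sum>g. x \<beta> g y \<delta>\<^sub>g\<close>, that is, the value of \<open>tau'\<close> at \<open>x \<otimes> y\<close>.\<close>

definition twist :: "'a \<Rightarrow> 'a \<Rightarrow> 'g \<Rightarrow> 'a" where
  "twist x y = (\<lambda>g\<in>carrier G. x \<otimes> \<beta> g y)"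

lemma twist_closed: "\<lbrakk>x \<in> carrier R; y \<in> carrier R\<rbrakk> \<Longrightarrow> twist x y \<in> carrier A"
  by (auto simp: twist_def skew_carrier intro!: D_mult_left \<beta>_in_D)

lemma twist_add_left:
  "\<lbrakk>x \<in> carrier R; x' \<in> carrier R; y \<in> carrier R\<rbrakk> \<Longrightarrow> twist (x \<oplus> x') y = twist x y \<oplus>\<^bsub>A\<^esub> twist x' y"
  by (auto simp: twist_def skew_add l_distr \<beta>_closed intro!: restrict_ext)

lemma twist_add_right:
  "\<lbrakk>x \<in> carrier R; y \<in> carrier R; y' \<in> carrier R\<rbrakk> \<Longrightarrow> twist x (y \<oplus> y') = twist x y \<oplus>\<^bsub>A\<^esub> twist x y'"
  by (auto simp: twist_def skew_add r_distr \<beta>_add \<beta>_closed intro!: restrict_ext)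

lemma twist_balanced:
  "\<lbrakk>x \<in> carrier R; b \<in> carrier B; y \<in> carrier R\<rbrakk> \<Longrightarrow> twist (x \<otimes> b) y = twist x (b \<otimes> y)"
  by (auto simp: twist_def \<beta>_invariant_left m_assoc invariant_closed \<beta>_closed intro!: restrict_ext)

text \<open>On a monomial \<open>c \<delta>\<^sub>g\<close>, both sides have the coefficient \<open>c \<beta> g x \<beta> k y\<close> at those \<open>k\<close> with the range of
\<open>g\<close>. For the other \<open>k\<close> that expression is zero by orthogonality of the summands.\<close>

lemma twist_act_left:
  assumes a: "a \<in> carrier A" and x: "x \<in> carrier R" and y: "y \<in> carrier R"
  shows "twist (act_left a x) y = a \<otimes>\<^bsub>A\<^esub> twist x y"
  using a
proof (induction rule: skew_induct)
  case (delta g c)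
  note cR = D_closed[OF delta]
  have d: "act_left (delta g c) x = c \<otimes> \<beta> g x"
    using delta x by (simp add: act_left_delta)
  show ?case
  proof (rule skew_eqI)
    show "twist (act_left (delta g c) x) y \<in> carrier A"
      using delta x y by (intro twist_closed act_left_closed delta_closed)
    show "delta g c \<otimes>\<^bsub>A\<^esub> twist x y \<in> carrier A"
      using delta x y by (intro skew_mult_closed twist_closed delta_closed)
    fix k assume k: "k \<in> carrier G"
    show "twist (act_left (delta g c) x) y k = (delta g c \<otimes>\<^bsub>A\<^esub> twist x y) k"
    proof (cases "gran G g = gran G k")
      case True
      let ?h = "gcomp G (ginv G g) k"
      note c = composable_ginv_left[OF delta(1) k True]
      have h: "?h \<in> carrier G" using gcomp_closed[OF c] .
      have gh: "(g, ?h) \<in> composable G" "gcomp G g ?h = k"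
        using delta h c k True by (auto simp: composable_def gran_gcomp[OF c] gran_ginv gcomp_ginv_cancel_left')
      have "\<beta> g (x \<otimes> \<beta> ?h y) = \<beta> g x \<otimes> (\<beta> k y \<otimes> u g)"
        using delta x y h \<beta>_composable[OF gh(1) y] gh(2) by (simp add: \<beta>_mult \<beta>_closed)
      also have "\<dots> = (\<beta> g x \<otimes> u g) \<otimes> \<beta> k y"
        using delta x y k by (simp add: m_assoc \<beta>_closed u_closed u_central)
      also have "\<dots> = \<beta> g x \<otimes> \<beta> k y"
        using delta x by (simp add: \<beta>_u)
      finally have "c \<otimes> \<beta> g (x \<otimes> \<beta> ?h y) = (c \<otimes> \<beta> g x) \<otimes> \<beta> k y"
        using delta cR x y k by (simp add: m_assoc \<beta>_closed)
      then show ?thesis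
        using delta_mult_apply[OF delta twist_closed[OF x y] k] True h k by (simp add: d twist_def)
    next
      case False
      have "(c \<otimes> \<beta> g x) \<otimes> \<beta> k y = \<zero>"
        using delta x y k cR False by (intro D_orthogonal[of g k] D_mult_right \<beta>_in_D) (auto simp: \<beta>_closed)
      then show ?thesis
        using delta_mult_apply[OF delta twist_closed[OF x y] k] False k by (simp add: d twist_def)
    qed
  qed
next
  case (add a b)
  then show ?case
    using x y by (simp add: add_act_left twist_add_left act_left_closed skew_l_distr twist_closed)
qed

text \<open>On a monomial \<open>c \<delta>\<^sub>h\<close>, both sides have the coefficient \<open>x \<beta> (k h\<^sup>-\<^sup>1) (y c)\<close> at those \<open>k\<close> with the
source of \<open>h\<close>. The composition rule leaves a factor \<open>1\<^sub>k\<close> on the left, which is absorbed because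
\<open>\<beta> (k h\<^sup>-\<^sup>1)\<close> maps \<open>D\<^sub>h\<close> into \<open>D\<^sub>k\<close>.\<close>

lemma twist_act_right:
  assumes a: "a \<in> carrier A" and x: "x \<in> carrier R" and y: "y \<in> carrier R"
  shows "twist x (act_right y a) = twist x y \<otimes>\<^bsub>A\<^esub> a"
  using a
proof (induction rule: skew_induct)
  case (delta h c)
  note cR = D_closed[OF delta] and i = ginv_closed[OF delta(1)]
  have d: "act_right y (delta h c) = \<beta> (ginv G h) (y \<otimes> c)"
    using delta y by (simp add: act_right_delta)
  show ?case
  proof (rule skew_eqI)
    show "twist x (act_right y (delta h c)) \<in> carrier A"
      using delta x y by (intro twist_closed act_right_closed delta_closed)
    show "twist x y \<otimes>\<^bsub>A\<^esub> delta h c \<in> carrier A"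
      using delta x y by (intro skew_mult_closed twist_closed delta_closed)
    fix k assume k: "k \<in> carrier G"
    show "twist x (act_right y (delta h c)) k = (twist x y \<otimes>\<^bsub>A\<^esub> delta h c) k"
    proof (cases "gdom G h = gdom G k")
      case True
      let ?g = "gcomp G k (ginv G h)"
      note co = composable_ginv_right[OF delta(1) k True]
      have g: "?g \<in> carrier G" using gcomp_closed[OF co] .
      have gh: "(?g, h) \<in> composable G" "gcomp G ?g h = k"
        using delta g co k True by (auto simp: composable_def gdom_gcomp[OF co] gdom_ginv gcomp_ginv_cancel_right')
      have "\<beta> k (\<beta> (ginv G h) (y \<otimes> c)) = \<beta> ?g y \<otimes> (\<beta> ?g c \<otimes> u k)"
        using \<beta>_composable[OF co] y cR g k by (simp add: m_closed \<beta>_mult m_assoc \<beta>_closed u_closed)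
      also have "\<dots> = \<beta> ?g y \<otimes> \<beta> ?g c"
        using \<beta>_D_in[OF gh(1) delta(2)] k by (simp add: gh(2) D_unit_right)
      finally have "x \<otimes> \<beta> k (\<beta> (ginv G h) (y \<otimes> c)) = (x \<otimes> \<beta> ?g y) \<otimes> \<beta> ?g c"
        using x y cR g by (simp add: m_assoc \<beta>_closed)
      then show ?thesis
        using mult_delta_apply[OF delta twist_closed[OF x y] k] True g k by (simp add: d twist_def)
    next
      case False
      then have "\<beta> k (\<beta> (ginv G h) (y \<otimes> c)) = \<zero>"
        using delta k y cR i by (intro \<beta>_not_composable) (auto simp: composable_def gran_ginv m_closed)
      then show ?thesis
        using mult_delta_apply[OF delta twist_closed[OF x y] k] False k x by (simp add: d twist_def r_null)
    qed
  qed
next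
  case (add a b)
  then show ?case
    using x y by (simp add: add_act_right twist_add_right act_right_closed skew_r_distr twist_closed)
qed

text \<open>Since \<open>\<beta> g\<close> is multiplicative, \<open>\<Sum>g. x \<beta> g y \<beta> g z = x \<Sum>g. \<beta> g (y z)\<close>.\<close>

lemma act_left_twist:
  assumes "x \<in> carrier R" "y \<in> carrier R" "z \<in> carrier R"
  shows "act_left (twist x y) z = x \<otimes> tr (y \<otimes> z)"
  unfolding trace_eq act_left_eq using assms
  by (subst abelian_group_hom.hom_finsum[OF mult_left_hom])
    (auto intro!: finsum_cong' simp: twist_def \<beta>_mult m_assoc m_closed \<beta>_closed)

text \<open>Here \<open>\<beta> g\<^sup>-\<^sup>1\<close> undoes \<open>\<beta> g\<close> up to a factor \<open>1\<^bsub>g\<^sup>-\<^sup>1\<^esub>\<close>, which \<open>\<beta> g\<^sup>-\<^sup>1 (x y)\<close> absorbs. The sum of the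
\<open>\<beta> g\<^sup>-\<^sup>1 (x y)\<close> is the trace, reindexed by inversion.\<close>

lemma act_right_twist:
  assumes x: "x \<in> carrier R" and y: "y \<in> carrier R" and z: "z \<in> carrier R"
  shows "act_right x (twist y z) = tr (x \<otimes> y) \<otimes> z"
proof -
  have "\<beta> (ginv G g) (x \<otimes> (y \<otimes> \<beta> g z)) = \<beta> (ginv G g) (x \<otimes> y) \<otimes> z" if g: "g \<in> carrier G" for g
  proof -
    have i: "ginv G g \<in> carrier G" using ginv_closed[OF g] .
    have "\<beta> (ginv G g) (x \<otimes> (y \<otimes> \<beta> g z)) = \<beta> (ginv G g) (x \<otimes> y) \<otimes> \<beta> (ginv G g) (\<beta> g z)"
      using x y z g i by (simp add: \<beta>_mult m_assoc m_closed \<beta>_closed)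
    also have "\<beta> (ginv G g) (\<beta> g z) = u (ginv G g) \<otimes> z"
      using \<beta>_inverse[OF i z] g i z by (simp add: ginv_ginv u_central)
    also have "\<beta> (ginv G g) (x \<otimes> y) \<otimes> (u (ginv G g) \<otimes> z) = \<beta> (ginv G g) (x \<otimes> y) \<otimes> z"
      using x y z i by (simp add: m_assoc[symmetric] m_closed \<beta>_closed u_closed \<beta>_u)
    finally show ?thesis .
  qed
  then have "act_right x (twist y z) = (\<Oplus>g\<in>carrier G. \<beta> (ginv G g) (x \<otimes> y) \<otimes> z)"
    unfolding act_right_eq[OF twist_closed[OF y z] x] using x y z
    by (intro finsum_cong') (auto simp: twist_def m_closed \<beta>_closed ginv_closed)
  also have "\<dots> = (\<Oplus>g\<in>carrier G. \<beta> (ginv G g) (x \<otimes> y)) \<otimes> z"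
    using x y z by (intro abelian_group_hom.hom_finsum[OF mult_right_hom, symmetric])
      (auto simp: m_closed \<beta>_closed ginv_closed)
  finally show ?thesis
    using x y by (simp add: trace_inverses m_closed)
qed

abbreviation \<tau> where "\<tau> \<equiv> tau G R \<alpha> u"

abbreviation \<tau>' where "\<tau>' \<equiv> tau' G R D \<alpha> u"

lemma \<tau>_lift: "\<tau> = tensor_lift (regular_bimod B) (\<lambda>x y. tr (x \<otimes> y))"
  by (simp add: tau_def tensor_lift_regular_bimod)

lemma \<tau>'_lift: "\<tau>' = tensor_lift (regular_bimod A) twist"
  by (simp add: tau'_def tensor_lift_regular_bimod twist_def[abs_def] \<beta>_def)

lemma regular_simps:
  "carrier (regular_bimod S) = carrier S" "add (regular_bimod S) = add S"
  "lact (regular_bimod S) = monoid.mult S" "ract (regular_bimod S) = monoid.mult S"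
  by (simp_all add: regular_bimod_def as_bimod_def)

lemma
  shows \<tau>_pure: "\<lbrakk>x \<in> carrier R; y \<in> carrier R\<rbrakk> \<Longrightarrow> \<tau> (pure_tensor A M' M x y) = tr (x \<otimes> y)"
    and \<tau>_hom: "\<tau> \<in> bimod_hom B B (tensor A M' M) (regular_bimod B)"
    and \<tau>_mem: "\<lbrakk>additive_subgroup H (regular_bimod B);
        \<And>x y. \<lbrakk>x \<in> carrier R; y \<in> carrier R\<rbrakk> \<Longrightarrow> tr (x \<otimes> y) \<in> H; C \<in> carrier (tensor A M' M)\<rbrakk>
      \<Longrightarrow> \<tau> C \<in> H"
proof -
  note simps = bimod_simps regular_simps invariant_simps trace_invariant m_closed l_distr r_distr trace_add
    trace_balanced m_assoc invariant_closed trace_mult_left trace_mult_right_assoc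
  note bim = R_bimodule_inv_skew R_bimodule_skew_inv regular_bimodule[OF invariant_ring]
  show "\<tau> (pure_tensor A M' M x y) = tr (x \<otimes> y)" if "x \<in> carrier R" "y \<in> carrier R"
    unfolding \<tau>_lift using that by (intro tensor_lift_pure[OF bim]) (simp_all add: simps)
  show "\<tau> \<in> bimod_hom B B (tensor A M' M) (regular_bimod B)"
    unfolding \<tau>_lift by (intro tensor_lift_hom[OF bim]) (simp_all add: simps)
  show "\<tau> C \<in> H" if "additive_subgroup H (regular_bimod B)"
    "\<And>x y. \<lbrakk>x \<in> carrier R; y \<in> carrier R\<rbrakk> \<Longrightarrow> tr (x \<otimes> y) \<in> H" "C \<in> carrier (tensor A M' M)"
    unfolding \<tau>_lift by (rule tensor_lift_mem[OF bim _ _ _ _ that(1) _ that(3)]) (simp_all add: simps that(2))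
qed

lemma
  shows \<tau>'_pure: "\<lbrakk>x \<in> carrier R; y \<in> carrier R\<rbrakk> \<Longrightarrow> \<tau>' (pure_tensor B M M' x y) = twist x y"
    and \<tau>'_hom: "\<tau>' \<in> bimod_hom A A (tensor B M M') (regular_bimod A)"
proof -
  note simps = bimod_simps regular_simps twist_closed twist_add_left twist_add_right twist_balanced
    twist_act_left twist_act_right
  note bim = R_bimodule_skew_inv R_bimodule_inv_skew regular_bimodule[OF skew_ring]
  show "\<tau>' (pure_tensor B M M' x y) = twist x y" if "x \<in> carrier R" "y \<in> carrier R"
    unfolding \<tau>'_lift using that by (intro tensor_lift_pure[OF bim]) (simp_all add: simps)
  show "\<tau>' \<in> bimod_hom A A (tensor B M M') (regular_bimod A)"
    unfolding \<tau>'_lift by (intro tensor_lift_hom[OF bim]) (simp_all add: simps)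
qed

lemma skew_morita_context: "morita_context A B M M' \<tau>' \<tau>"
  by (intro morita_context.intro morita_context_axioms.intro R_bimodule_skew_inv R_bimodule_inv_skew
      \<tau>_hom \<tau>'_hom)
    (simp_all add: bimod_simps \<tau>_pure \<tau>'_pure act_left_twist act_right_twist)

text \<open>With \<open>\<tau>_mem\<close>, this shows that all values of \<open>\<tau>\<close>, and not only those on pure tensors, are traces.\<close>

lemma trace_range_subgroup: "additive_subgroup (tr ` carrier R) (regular_bimod B)"
proof -
  have "abelian_group_hom R (regular_bimod B) tr"
    using bimodule.axioms(3)[OF regular_bimodule[OF invariant_ring]]
    by (intro abelian_group_homI_additive abelian_group_axioms)
      (auto simp: regular_simps invariant_simps trace_invariant trace_add)
  then show ?thesis
    using group_hom.img_is_subgroup[OF abelian_group_hom.a_group_hom]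
    by (intro additive_subgroupI) fastforce
qed

lemma \<tau>_surjective_iff:
  "\<tau> ` carrier (tensor A M' M) = carrier B \<longleftrightarrow> (\<exists>x\<in>carrier R. tr x = unity_R)"
proof
  assume "\<tau> ` carrier (tensor A M' M) = carrier B"
  moreover have "unity_R \<in> carrier B"
    using B.one_closed by (simp add: invariant_simps)
  ultimately obtain C where "C \<in> carrier (tensor A M' M)" "\<tau> C = unity_R"
    by force
  then have "unity_R \<in> tr ` carrier R"
    using \<tau>_mem[OF trace_range_subgroup, of C] by (auto simp: m_closed)
  then show "\<exists>x\<in>carrier R. tr x = unity_R"
    by force
next
  assume "\<exists>x\<in>carrier R. tr x = unity_R"
  then obtain x where x: "x \<in> carrier R" "tr x = unity_R" by blast
  have "\<tau> ` carrier (tensor A M' M) \<subseteq> carrier B"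
    using \<tau>_hom by (auto simp: bimod_hom_def regular_simps)
  moreover have "b \<in> \<tau> ` carrier (tensor A M' M)" if b: "b \<in> carrier B" for b
  proof
    show "b = \<tau> (pure_tensor A M' M b x)"
      using b x by (simp add: \<tau>_pure invariant_closed trace_mult_left unity_right)
    show "pure_tensor A M' M b x \<in> carrier (tensor A M' M)"
      using b x by (intro pure_tensor_closed[OF R_bimodule_inv_skew R_bimodule_skew_inv])
        (simp_all add: bimod_simps invariant_closed)
  qed
  ultimately show "\<tau> ` carrier (tensor A M' M) = carrier B" by blast
qed

end

theorem proposition4p4:
  fixes G :: "('g, 'k) gpd_scheme" and R :: "('a, 'm) ring_scheme"
    and D :: "'g \<Rightarrow> 'a set" and \<alpha> :: "'g \<Rightarrow> 'a \<Rightarrow> 'a" and u :: "'g \<Rightarrow> 'a"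
  assumes "partial_action G R D \<alpha>"
    and "finite (carrier G)"
    and "\<forall>g\<in>carrier G. is_identity R (D g) (u g)"
    and "internal_direct_sum R (identities G) D"
  defines "A \<equiv> skew_ring G R D \<alpha> u"
    and "B \<equiv> invariant_ring G R \<alpha> u"
    and "M \<equiv> R_skew_inv G R \<alpha> u"
    and "M' \<equiv> R_inv_skew G R \<alpha>"
    and "\<tau> \<equiv> tau G R \<alpha> u"
    and "\<tau>' \<equiv> tau' G R D \<alpha> u"
  shows "(\<forall>x\<in>carrier R. \<forall>y\<in>carrier R.
            \<tau> (pure_tensor A M' M x y) = trace_map G R \<alpha> u (x \<otimes>\<^bsub>R\<^esub> y)) \<and>
         (\<forall>x\<in>carrier R. \<forall>y\<in>carrier R.
            \<tau>' (pure_tensor B M M' x y) =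
              (\<lambda>g\<in>carrier G. x \<otimes>\<^bsub>R\<^esub> \<alpha> g (y \<otimes>\<^bsub>R\<^esub> u (ginv G g)))) \<and>
         morita_context A B M M' \<tau>' \<tau> \<and>
         (\<tau> ` carrier (tensor A M' M) = carrier B \<longleftrightarrow>
            (\<exists>x\<in>carrier R. trace_map G R \<alpha> u x = unity G R u))"
proof -
  interpret unital_partial_action G R D \<alpha> u
    using assms(1-4) by (intro unital_partial_action.intro unital_partial_action_axioms.intro) auto
  show ?thesis
    unfolding A_def B_def M_def M'_def \<tau>_def \<tau>'_def
    using \<tau>_pure \<tau>'_pure skew_morita_context \<tau>_surjective_iff
    by (simp add: twist_def \<beta>_def)
qed

end
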